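(* For every $n\ge1$ and every even $m\ge4$ there is a function $$f(x)=c_0+\sum_{k=1}^{w}d_k\,\sigma(a_k^{\top}x+b_k),\qquad x\in\mathbb{R}^n,$$ with $\sigma(u)=(1+e^{-u})^{-1}$ the logistic sigmoid, $w=n(m+2)$ units, $c_0,d_k,b_k\in\mathbb{R}$, and weights $a_k\in\mathbb{Q}^n$ of lattice constant $L=1$, such that $0$ is a regular value of $f$, the zero set $V=\{x:f(x)=0\}$ is a smooth compact hypersurface, and $$\mathrm{mdeg}(V)\ \ge\ 2\left(\frac{m-2}{2}\right)^{n}.$$ In particular, for fixed $n$ this is $\Omega(w^n)$.
   Context: Lattice constant: if $a_1,\dots,a_w\in\mathbb{Q}^n$ have common denominator $q\in\mathbb{N}_{>0}$ (i.e. $q\,a_k\in\mathbb{Z}^n$ for all $k$), the lattice constant is $L=q\max_{k,i}|a_{ki}|$. Gauss-map degree: for a smooth hypersurface $V\subset\mathbb{R}^n$, let $S(NV)=\{(x,u)\in V\times S^{n-1}: u\perp T_xV\}$ be the normal sphere bundle (both unit normals over each point) and $\gamma\colon S(NV)\to S^{n-1}$, $(x,u)\mapsto u$, the generalised Gauss map. Then $\mathrm{mdeg}(V)=\sup\{|\gamma^{-1}(v)|: v\in S^{n-1}\text{ a regular value of }\gamma\}$. *)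

theory Defs
  imports "HOL-Analysis.Analysis" "HOL-Library.Extended_Real"
begin

text \<open>Networks with one hidden layer of logistic units, and the lattice constant of their weights.\<close>

definition logistic :: "real \<Rightarrow> real" where
  "logistic u = inverse (1 + exp (- u))"

definition sigmoid_net ::
  "nat \<Rightarrow> real \<Rightarrow> (nat \<Rightarrow> real) \<Rightarrow> (nat \<Rightarrow> 'a::real_inner) \<Rightarrow> (nat \<Rightarrow> real) \<Rightarrow> 'a \<Rightarrow> real" where
  "sigmoid_net w c0 d a b x = c0 + (\<Sum>k=1..w. d k * logistic (a k \<bullet> x + b k))"

text \<open>The lattice constant is computed from a common denominator \<open>q\<close> of the weights, so it is a
  relation. For \<open>L = 1\<close> the integers \<open>q \<cdot> a\<^sub>k\<^sub>i\<close> have maximal absolute value \<open>1\<close>, which forces \<open>q\<close> to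
  be the least common denominator.\<close>

definition has_lattice_constant :: "(real ^ 'n) set \<Rightarrow> real \<Rightarrow> bool" where
  "has_lattice_constant A L \<longleftrightarrow>
     (\<exists>q::nat. q > 0 \<and> (\<forall>v\<in>A. \<forall>i. real q * v $ i \<in> \<int>) \<and>
        L = real q * Max {\<bar>v $ i\<bar> | v i. v \<in> A})"

text \<open>On an open set of a Euclidean space, the following is \<open>C\<^sup>k\<close>, respectively smoothness: all
  iterated directional derivatives exist and are themselves differentiable, respectively continuous
  at the last order.\<close>

primrec Ck_on ::
  "nat \<Rightarrow> 'a::euclidean_space set \<Rightarrow> ('a \<Rightarrow> 'b::real_normed_vector) \<Rightarrow> bool" where
  "Ck_on 0 S f \<longleftrightarrow> continuous_on S f"
| "Ck_on (Suc k) S f \<longleftrightarrow>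
     (\<forall>x\<in>S. f differentiable (at x)) \<and> (\<forall>v. Ck_on k S (\<lambda>x. frechet_derivative f (at x) v))"

definition smooth_on :: "'a::euclidean_space set \<Rightarrow> ('a \<Rightarrow> 'b::real_normed_vector) \<Rightarrow> bool" where
  "smooth_on S f \<longleftrightarrow> (\<forall>k. Ck_on k S f)"

text \<open>Smooth embedded hypersurfaces (without boundary): around each point some diffeomorphism
  \<open>\<phi>\<close> between open sets, with inverse \<open>\<psi>\<close>, straightens the set to a hyperplane.\<close>

definition smooth_hypersurface :: "'a::euclidean_space set \<Rightarrow> bool" where
  "smooth_hypersurface V \<longleftrightarrow>
     (\<forall>p\<in>V. \<exists>U W \<phi> \<psi>. \<exists>h::'a.
        open U \<and> p \<in> U \<and> open W \<and> homeomorphism U W \<phi> \<psi> \<and> smooth_on U \<phi> \<and> smooth_on W \<psi> \<and>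
        h \<noteq> 0 \<and> \<phi> ` (U \<inter> V) = {y \<in> W. h \<bullet> y = 0})"

text \<open>Tangent vectors to a submanifold of a Euclidean space are the velocities of the smooth curves
  that run in it.\<close>

definition tangent_space :: "'a::euclidean_space set \<Rightarrow> 'a \<Rightarrow> 'a set" where
  "tangent_space M p =
     {v. \<exists>c. \<exists>e>0. smooth_on {-e<..<e} c \<and> c ` {-e<..<e} \<subseteq> M \<and> c 0 = p \<and>
         (c has_vector_derivative v) (at (0::real))}"

text \<open>Regular values of the map \<open>M \<rightarrow> N\<close> between submanifolds that is the restriction of a map \<open>F\<close>
  on the ambient Euclidean space: the differential at \<open>p\<close> is the restriction of the ambient
  derivative to the tangent space. Points of \<open>N\<close> with empty fibre count as regular values.\<close>

definition regular_value ::
  "'a::euclidean_space set \<Rightarrow> 'b::euclidean_space set \<Rightarrow> ('a \<Rightarrow> 'b) \<Rightarrow> 'b \<Rightarrow> bool" where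
  "regular_value M N F y \<longleftrightarrow> y \<in> N \<and>
     (\<forall>p\<in>M. F p = y \<longrightarrow> F differentiable (at p) \<and>
        frechet_derivative F (at p) ` tangent_space M p = tangent_space N y)"

definition unit_normal_bundle :: "'a::euclidean_space set \<Rightarrow> ('a \<times> 'a) set" where
  "unit_normal_bundle V =
     {(x, u). x \<in> V \<and> u \<in> sphere 0 1 \<and> (\<forall>v\<in>tangent_space V x. orthogonal u v)}"

definition gauss_map :: "'a \<times> 'a \<Rightarrow> 'a" where
  "gauss_map = (\<lambda>(x, u). u)"

definition ecard :: "'a set \<Rightarrow> enat" where
  "ecard S = (if finite S then enat (card S) else \<infinity>)"

definition mdeg :: "'a::euclidean_space set \<Rightarrow> enat" where
  "mdeg V =
     (SUP v \<in> {v. regular_value (unit_normal_bundle V) (sphere 0 1) gauss_map v}.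
        ecard {p \<in> unit_normal_bundle V. gauss_map p = v})"

end

theory Submission
  imports Defs "HOL-Real_Asymp.Real_Asymp"
begin

text \<open>Take \<open>f(x) = c\<^sub>0 + g(x\<^sub>1) + \<dots> + g(x\<^sub>n)\<close>, where \<open>g\<close> is a one-variable sigmoid network with
  \<open>N = (m - 2)/2\<close> widely spaced bumps of height about \<open>1\<close> and \<open>c\<^sub>0\<close> is close to \<open>- (n - 1/2)\<close>. Then \<open>f\<close>
  is negative as soon as one coordinate is large, so the zero set is compact. A unit beyond
  those of the bumps, with generic amplitude, makes every critical point of \<open>g\<close> nondegenerate, and a
  generic \<open>c\<^sub>0\<close> makes \<open>0\<close> a regular value. Because the Hessian of \<open>f\<close> is diagonal, a coordinate
  axis is then a regular value of the Gauss map: the normal at \<open>x\<close> is the \<open>i\<close>-th axis iff every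
  other coordinate of \<open>x\<close> is critical for \<open>g\<close>. Choosing for these coordinates one of the \<open>N\<close> peaks
  each and for \<open>x\<^sub>i\<close> one of the \<open>2 N\<close> flanks gives \<open>2 N\<^sup>n\<close> points in the fibre.\<close>

section \<open>Smooth maps\<close>

lemma frechet_derivative_eqI:
  "(f has_derivative D) (at x) \<Longrightarrow> frechet_derivative f (at x) = D"
  by (metis frechet_derivative_at)

text \<open>Openness makes \<open>f\<close> and \<open>g\<close> agree near each point of
  \<open>S\<close>, so they have the same derivatives there, and the directional derivatives satisfy
  the hypothesis one order lower.\<close>

lemma Ck_on_cong:
  assumes "open S" "\<And>x. x \<in> S \<Longrightarrow> f x = g x"
  shows "Ck_on k S f \<longleftrightarrow> Ck_on k S g"
  using assms(2)
proof (induction k arbitrary: f g)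
  case 0
  then show ?case by (auto cong: continuous_on_cong)
next
  case (Suc k)
  have der: "(f has_derivative D) (at x) \<longleftrightarrow> (g has_derivative D) (at x)" if "x \<in> S" for x D
    using that Suc.prems assms(1) has_derivative_transform_within_open[of f D x UNIV S g]
      has_derivative_transform_within_open[of g D x UNIV S f] by auto
  then have "f differentiable at x \<longleftrightarrow> g differentiable at x" if "x \<in> S" for x
    using that by (auto simp: differentiable_def)
  moreover have "frechet_derivative f (at x) = frechet_derivative g (at x)" if "x \<in> S" for x
    using that der by (simp add: frechet_derivative_def)
  ultimately show ?case
    using Suc.IH[of "\<lambda>x. frechet_derivative f (at x) v" "\<lambda>x. frechet_derivative g (at x) v" for v]
    by auto
qed

text \<open>The working introduction rule: it replaces the choice operator behind
  \<open>frechet_derivative\<close> by an explicit derivative \<open>D\<close>.\<close>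

lemma Ck_on_SucI:
  assumes "open S" "\<And>x. x \<in> S \<Longrightarrow> (f has_derivative D x) (at x)"
    and "\<And>v. Ck_on k S (\<lambda>x. D x v)"
  shows "Ck_on (Suc k) S f"
proof -
  have "Ck_on k S (\<lambda>x. frechet_derivative f (at x) v)" for v
    by (rule Ck_on_cong[OF assms(1), THEN iffD1, OF _ assms(3)[of v]])
       (simp add: frechet_derivative_eqI[OF assms(2)])
  then show ?thesis
    using assms(2) by (auto simp: differentiable_def)
qed

lemma Ck_on_SucD:
  assumes "Ck_on (Suc k) S f" "x \<in> S"
  shows "(f has_derivative frechet_derivative f (at x)) (at x)"
  using assms frechet_derivative_works by auto

lemma Ck_on_le_Suc: "Ck_on (Suc k) S f \<Longrightarrow> Ck_on k S f"
proof (induction k arbitrary: f)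
  case 0
  then show ?case
    by (auto intro!: continuous_at_imp_continuous_on differentiable_imp_continuous_within)
next
  case (Suc k)
  then show ?case by (metis Ck_on.simps(2))
qed

lemma Ck_on_const [simp]: "open S \<Longrightarrow> Ck_on k S (\<lambda>x. c)"
  by (induction k arbitrary: c) (auto intro!: Ck_on_SucI[where D = "\<lambda>_ _. 0"] simp del: Ck_on.simps(2))

lemma Ck_on_bounded_linear_compose:
  assumes "bounded_linear L" "open S" "Ck_on k S f"
  shows "Ck_on k S (\<lambda>x. L (f x))"
  using assms(3)
proof (induction k arbitrary: f)
  case 0
  then show ?case using assms(1) by (auto intro: bounded_linear.continuous_on)
next
  case (Suc k)
  show ?case
    by (rule Ck_on_SucI[OF assms(2), where D = "\<lambda>x v. L (frechet_derivative f (at x) v)"])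
       (use Suc in \<open>auto intro!: bounded_linear.has_derivative[OF assms(1)] Suc.IH simp: frechet_derivative_works\<close>)
qed

lemma Ck_on_id: "open S \<Longrightarrow> Ck_on k S (\<lambda>x. x)"
  by (cases k) (auto intro!: Ck_on_SucI[where D = "\<lambda>_ v. v"] simp del: Ck_on.simps(2) simp: continuous_on_id)

lemma Ck_on_add:
  assumes "open S" "Ck_on k S f" "Ck_on k S g"
  shows "Ck_on k S (\<lambda>x. f x + g x)"
  using assms(2,3)
proof (induction k arbitrary: f g)
  case 0
  then show ?case by (auto intro: continuous_on_add)
next
  case (Suc k)
  show ?case
    by (rule Ck_on_SucI[OF assms(1), where
          D = "\<lambda>x v. frechet_derivative f (at x) v + frechet_derivative g (at x) v"])
       (use Suc in \<open>auto intro!: has_derivative_add Suc.IH simp: frechet_derivative_works\<close>)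
qed

lemma Ck_on_sum:
  assumes "open S" "\<And>i. i \<in> I \<Longrightarrow> Ck_on k S (f i)"
  shows "Ck_on k S (\<lambda>x. \<Sum>i\<in>I. f i x)"
  using assms(2) by (induction I rule: infinite_finite_induct) (auto intro: Ck_on_add Ck_on_const assms(1))

lemma Ck_on_bilinear:
  assumes "bounded_bilinear bop" "open S" "Ck_on k S f" "Ck_on k S g"
  shows "Ck_on k S (\<lambda>x. bop (f x) (g x))"
  using assms(3,4)
proof (induction k arbitrary: f g)
  case 0
  then show ?case using assms(1) by (auto intro: bounded_bilinear.continuous_on)
next
  case (Suc k)
  note le = Ck_on_le_Suc[OF Suc.prems(1)] Ck_on_le_Suc[OF Suc.prems(2)]
  show ?case
    by (rule Ck_on_SucI[OF assms(2), where
          D = "\<lambda>x v. bop (f x) (frechet_derivative g (at x) v) + bop (frechet_derivative f (at x) v) (g x)"])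
       (use Suc le in \<open>auto intro!: bounded_bilinear.FDERIV[OF assms(1)] Ck_on_add assms(2) Suc.IH
          simp: frechet_derivative_works\<close>)
qed

text \<open>Chain rule with induction on the order, for a fixed inner map \<open>f\<close> and all
  \<open>h\<close> at once: after one differentiation the outer maps are the directional derivatives
  of \<open>h\<close>.\<close>

lemma Ck_on_compose:
  fixes f :: "'a::euclidean_space \<Rightarrow> 'b::euclidean_space"
    and h :: "'b \<Rightarrow> 'c::real_normed_vector"
  assumes "open S" "open T" "f ` S \<subseteq> T" "Ck_on k S f" "Ck_on k T h"
  shows "Ck_on k S (\<lambda>x. h (f x))"
  using assms(4,5)
proof (induction k arbitrary: h)
  case 0
  then show ?case using assms(3) by (auto intro: continuous_on_compose2)
next
  case (Suc k)
  let ?D = "\<lambda>x v. frechet_derivative h (at (f x)) (frechet_derivative f (at x) v)"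
  have fT: "f x \<in> T" if "x \<in> S" for x
    using that assms(3) by auto
  have der: "((\<lambda>x. h (f x)) has_derivative ?D x) (at x)" if "x \<in> S" for x
    using diff_chain_at[OF Ck_on_SucD[OF Suc.prems(1) that] Ck_on_SucD[OF Suc.prems(2) fT[OF that]]]
    by (simp add: o_def)
  \<comment> \<open>The chain rule differentiates \<open>h\<close> in a direction that varies with
    \<open>x\<close>, whereas \<open>Ck_on\<close> speaks of fixed directions only. Expanding the
    direction in the basis leaves products of coefficients with derivatives of \<open>h\<close>
    along fixed basis vectors.\<close>
  have "Ck_on k S (\<lambda>x. \<Sum>b\<in>Basis. (frechet_derivative f (at x) v \<bullet> b) *\<^sub>R frechet_derivative h (at (f x)) b)" for v
    using Suc.prems Suc.IH[of "\<lambda>y. frechet_derivative h (at y) b" for b] Ck_on_le_Suc[OF Suc.prems(1)]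
    by (intro Ck_on_sum Ck_on_bilinear[OF bounded_bilinear_scaleR]
        Ck_on_bounded_linear_compose[OF bounded_linear_inner_left] assms) auto
  moreover have "?D x v = (\<Sum>b\<in>Basis. (frechet_derivative f (at x) v \<bullet> b) *\<^sub>R frechet_derivative h (at (f x)) b)"
    if "x \<in> S" for x v
  proof -
    have "linear (frechet_derivative h (at (f x)))"
      using Ck_on_SucD[OF Suc.prems(2) fT[OF that]] has_derivative_linear by blast
    then show ?thesis
      by (subst euclidean_representation[of "frechet_derivative f (at x) v", symmetric])
         (simp only: linear_sum linear_scale)
  qed
  ultimately have "Ck_on k S (\<lambda>x. ?D x v)" for v
    by (subst Ck_on_cong[OF assms(1)])
  then show ?case
    using Ck_on_SucI[OF assms(1) der] by blast
qed

lemma smooth_on_cong: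
  "open S \<Longrightarrow> (\<And>x. x \<in> S \<Longrightarrow> f x = g x) \<Longrightarrow> smooth_on S f \<longleftrightarrow> smooth_on S g"
  unfolding smooth_on_def using Ck_on_cong by blast

lemma smooth_on_const [simp]: "open S \<Longrightarrow> smooth_on S (\<lambda>x. c)"
  and smooth_on_id: "open S \<Longrightarrow> smooth_on S (\<lambda>x. x)"
  and smooth_on_add: "open S \<Longrightarrow> smooth_on S f \<Longrightarrow> smooth_on S g \<Longrightarrow> smooth_on S (\<lambda>x. f x + g x)"
  and smooth_on_sum: "open S \<Longrightarrow> (\<And>i. i \<in> I \<Longrightarrow> smooth_on S (F i)) \<Longrightarrow> smooth_on S (\<lambda>x. \<Sum>i\<in>I. F i x)"
  and smooth_on_scaleR: "open S \<Longrightarrow> smooth_on S r \<Longrightarrow> smooth_on S f \<Longrightarrow> smooth_on S (\<lambda>x. r x *\<^sub>R f x)"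
  and smooth_on_mult: "open S \<Longrightarrow> smooth_on S r \<Longrightarrow> smooth_on S s \<Longrightarrow> smooth_on S (\<lambda>x. r x * s x)"
  for r s :: "_ \<Rightarrow> real"
  unfolding smooth_on_def
  by (auto intro: Ck_on_id Ck_on_add Ck_on_sum Ck_on_bilinear[OF bounded_bilinear_scaleR]
      Ck_on_bilinear[OF bounded_bilinear_mult])

lemma smooth_on_bounded_linear_compose:
  "bounded_linear L \<Longrightarrow> open S \<Longrightarrow> smooth_on S f \<Longrightarrow> smooth_on S (\<lambda>x. L (f x))"
  unfolding smooth_on_def using Ck_on_bounded_linear_compose by blast

lemma smooth_on_diff: "open S \<Longrightarrow> smooth_on S f \<Longrightarrow> smooth_on S g \<Longrightarrow> smooth_on S (\<lambda>x. f x - g x)"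
  using smooth_on_add[of S f "\<lambda>x. - g x"] smooth_on_bounded_linear_compose[of uminus S g]
  by (simp add: bounded_linear_minus bounded_linear_ident)

lemma smooth_on_compose:
  fixes f :: "'a::euclidean_space \<Rightarrow> 'b::euclidean_space"
    and h :: "'b \<Rightarrow> 'c::real_normed_vector"
  assumes "smooth_on T h" "smooth_on S f" "open S" "open T" "f ` S \<subseteq> T"
  shows "smooth_on S (\<lambda>x. h (f x))"
  using assms unfolding smooth_on_def by (blast intro: Ck_on_compose)

lemma smooth_on_subset:
  assumes "smooth_on S f" "T \<subseteq> S"
  shows "smooth_on T f"
proof -
  have "Ck_on k T f" if "Ck_on k S f" for k
    using that assms(2)
    by (induction k arbitrary: f) (auto intro: continuous_on_subset)
  then show ?thesis
    using assms(1) by (simp add: smooth_on_def)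
qed

lemma smooth_on_vecI:
  fixes F :: "'a::euclidean_space \<Rightarrow> real ^ 'n"
  assumes "open S" "\<And>i. smooth_on S (\<lambda>x. F x $ i)"
  shows "smooth_on S F"
proof -
  have "F = (\<lambda>x. \<Sum>i\<in>UNIV. (F x $ i) *\<^sub>R axis i 1)"
    by (auto simp: vec_eq_iff axis_def if_distrib cong: if_cong)
  moreover have "smooth_on S (\<lambda>x. \<Sum>i\<in>UNIV. (F x $ i) *\<^sub>R axis i (1::real) :: real ^ 'n)"
    using assms by (intro smooth_on_sum smooth_on_scaleR) auto
  ultimately show ?thesis
    by (metis (no_types))
qed

lemma smooth_on_nth: "open S \<Longrightarrow> smooth_on S F \<Longrightarrow> smooth_on S (\<lambda>x. F x $ i)"
  for F :: "'a::euclidean_space \<Rightarrow> real ^ 'n"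
  by (rule smooth_on_bounded_linear_compose[OF bounded_linear_vec_nth])

lemma smooth_on_Pair:
  assumes "open S" "smooth_on S f" "smooth_on S g"
  shows "smooth_on S (\<lambda>x. (f x, g x))"
proof -
  have "smooth_on S (\<lambda>x. (f x, 0) + (0, g x))"
    using assms by (intro smooth_on_add smooth_on_bounded_linear_compose[of "\<lambda>y. (y, 0)"]
        smooth_on_bounded_linear_compose[of "\<lambda>y. (0, y)"] bounded_linear_Pair
        bounded_linear_zero bounded_linear_ident)
  then show ?thesis by simp
qed

section \<open>Smooth functions of one real variable and their local inverses\<close>

lemma has_real_derivative_imp_has_derivative:
  fixes h :: "real \<Rightarrow> real"
  assumes "(h has_real_derivative c) (at x)"
  shows "(h has_derivative (\<lambda>v. v * c)) (at x)"
proof -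
  have "(\<lambda>v. v * c) = (*) c"
    by (auto simp: mult.commute)
  then show ?thesis
    using assms by (simp add: has_field_derivative_def)
qed

lemma Ck_on_realI:
  fixes h :: "real \<Rightarrow> real"
  assumes "open S" "\<And>x. x \<in> S \<Longrightarrow> (h has_real_derivative h' x) (at x)" "Ck_on k S h'"
  shows "Ck_on (Suc k) S h"
  by (rule Ck_on_SucI[OF assms(1) has_real_derivative_imp_has_derivative[OF assms(2)]])
     (simp_all add: Ck_on_bilinear[OF bounded_bilinear_mult assms(1) Ck_on_const[OF assms(1)] assms(3)])

text \<open>Since the derivative of a member is again a member, induction on the order needs no
  formula for higher derivatives. The families in use are multiples of powers and polynomials in
  \<open>logistic\<close>.\<close>

lemma smooth_on_real_family:
  fixes P :: "(real \<Rightarrow> real) set"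
  assumes "open S" "h \<in> P"
    and step: "\<And>h. h \<in> P \<Longrightarrow> \<exists>h'\<in>P. \<forall>x\<in>S. (h has_real_derivative h' x) (at x)"
  shows "smooth_on S h"
proof -
  have "Ck_on k S h" if "h \<in> P" for k
    using that
  proof (induction k arbitrary: h)
    case 0
    then show ?case using step[OF 0]
      by (auto intro!: continuous_at_imp_continuous_on intro: DERIV_isCont)
  next
    case (Suc k)
    then show ?case using step[OF Suc.prems] assms(1) Ck_on_realI by blast
  qed
  then show ?thesis using assms(2) by (simp add: smooth_on_def)
qed

lemma smooth_on_deriv:
  fixes h :: "real \<Rightarrow> real"
  assumes "smooth_on S h" "open S" "\<And>x. x \<in> S \<Longrightarrow> (h has_real_derivative h' x) (at x)"
  shows "smooth_on S h'"
proof -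
  have "Ck_on k S h'" for k
  proof -
    have "Ck_on k S (\<lambda>x. frechet_derivative h (at x) 1)"
      using assms(1) unfolding smooth_on_def by (metis Ck_on.simps(2))
    moreover have "frechet_derivative h (at x) 1 = h' x" if "x \<in> S" for x
      using frechet_derivative_eqI[OF has_real_derivative_imp_has_derivative[OF assms(3)[OF that]]] by simp
    ultimately show ?thesis
      by (subst (asm) Ck_on_cong[OF assms(2)])
  qed
  then show ?thesis by (simp add: smooth_on_def)
qed

lemma smooth_on_powr: "smooth_on {0<..} (\<lambda>x::real. x powr a)"
proof (rule smooth_on_real_family[where P = "{\<lambda>x. c * x powr a | c a. True}"])
  show "(\<lambda>x. x powr a) \<in> {\<lambda>x. c * x powr a |c a. True}"
    by (force intro: exI[of _ 1])
  fix h :: "real \<Rightarrow> real" assume "h \<in> {\<lambda>x. c * x powr a |c a. True}"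
  then obtain c a where h: "h = (\<lambda>x. c * x powr a)" by auto
  have "\<forall>x\<in>{0<..}. (h has_real_derivative (c * a) * x powr (a - 1)) (at x)"
    unfolding h by (auto intro!: derivative_eq_intros)
  then show "\<exists>h'\<in>{\<lambda>x. c * x powr a |c a. True}. \<forall>x\<in>{0<..}. (h has_real_derivative h' x) (at x)"
    by (intro bexI[of _ "\<lambda>x. (c * a) * x powr (a - 1)"]) auto
qed auto

lemma smooth_on_inverse:
  fixes f :: "'a::euclidean_space \<Rightarrow> real"
  assumes "open S" "smooth_on S f" "\<And>x. x \<in> S \<Longrightarrow> f x \<noteq> 0"
  shows "smooth_on S (\<lambda>x. inverse (f x))"
proof -
  \<comment> \<open>Real powers are known to be smooth on the positive reals only; squaring makes
    the base positive whatever the sign of \<open>f x\<close>.\<close>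
  have "smooth_on S (\<lambda>x. f x * (f x * f x) powr (- 1))"
    using assms by (intro smooth_on_mult smooth_on_compose[OF smooth_on_powr]) (auto simp: not_square_less_zero less_le)
  then show ?thesis
    by (rule smooth_on_cong[OF assms(1), THEN iffD1, rotated])
       (use assms(3) in \<open>auto simp: powr_minus field_simps\<close>)
qed

text \<open>Bootstrapping: the derivative of \<open>h\<close> is \<open>inverse (g' (h y))\<close>,
  so \<open>h\<close> being C^k makes its derivative C^k and hence \<open>h\<close> itself C^(k+1).
  The induction starts from continuity.\<close>

lemma smooth_on_inverse_fun:
  fixes g h :: "real \<Rightarrow> real"
  assumes "open I" "open J" "smooth_on I g" "h ` J \<subseteq> I" "\<And>y. y \<in> J \<Longrightarrow> g (h y) = y"
    and der: "\<And>t. t \<in> I \<Longrightarrow> (g has_real_derivative g' t) (at t)" "\<And>t. t \<in> I \<Longrightarrow> g' t \<noteq> 0"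
    and cont: "continuous_on J h"
  shows "smooth_on J h"
proof -
  have smooth: "smooth_on I (\<lambda>t. inverse (g' t))"
    using smooth_on_inverse[OF assms(1) smooth_on_deriv[OF assms(3,1) der(1)] der(2)] .
  have dh: "(h has_real_derivative inverse (g' (h y))) (at y)" if y: "y \<in> J" for y
  proof -
    obtain e where "e > 0" "ball y e \<subseteq> J"
      using open_contains_ball_eq[OF assms(2)] y by blast
    then obtain a b where ab: "y \<in> {a<..<b}" "{a<..<b} \<subseteq> J"
      using that[of "y - e" "y + e"] by (simp add: ball_eq_greaterThanLessThan)
    show ?thesis
      by (rule DERIV_inverse_function[of g "g' (h y)" h y a b])
         (use ab assms der y in \<open>auto intro: continuous_on_interior simp: continuous_on_eq_continuous_at\<close>)
  qed
  have "Ck_on k J h" for k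
  proof (induction k)
    case 0
    then show ?case using cont by simp
  next
    case (Suc k)
    have "Ck_on k J (\<lambda>y. inverse (g' (h y)))"
      by (rule Ck_on_compose[OF assms(2,1,4) Suc]) (use smooth in \<open>simp add: smooth_on_def\<close>)
    then show ?case using Ck_on_realI[OF assms(2) dh] by blast
  qed
  then show ?thesis by (simp add: smooth_on_def)
qed

text \<open>By continuity \<open>g'\<close> has no zero on some ball around \<open>t0\<close>, so
  Rolle's theorem gives injectivity there, and invariance of domain gives an open image and a
  continuous inverse.\<close>

lemma local_smooth_inverse:
  fixes g :: "real \<Rightarrow> real"
  assumes smooth: "smooth_on UNIV g" and dg: "\<And>t. (g has_real_derivative g' t) (at t)"
    and "g' t0 \<noteq> 0"
  obtains I h where "open I" "t0 \<in> I" "open (g ` I)" "smooth_on (g ` I) h"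
    "\<And>t. t \<in> I \<Longrightarrow> h (g t) = t"
proof -
  have "smooth_on UNIV g'"
    using smooth_on_deriv[OF smooth _ dg] by simp
  then have "continuous_on UNIV g'"
    unfolding smooth_on_def by (metis Ck_on.simps(1))
  then have "open {t. g' t \<noteq> 0}"
    by (simp add: open_Collect_neq)
  then obtain e where e: "e > 0" "ball t0 e \<subseteq> {t. g' t \<noteq> 0}"
    using assms(3) open_contains_ball_eq by blast
  define I where "I = ball t0 e"
  have I: "g' t \<noteq> 0" if "t \<in> I" for t
    using e that by (auto simp: I_def)
  have contg: "continuous_on A g" for A
    using dg by (meson DERIV_isCont continuous_at_imp_continuous_on)
  have noteq: "g a \<noteq> g b" if "a \<in> I" "b \<in> I" "a < b" for a b
  proof
    assume "g a = g b"
    obtain z where "a < z" "z < b" "(\<lambda>v. v * g' z) = (\<lambda>v. 0)"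
      using Rolle_deriv[OF \<open>a < b\<close> \<open>g a = g b\<close> contg has_real_derivative_imp_has_derivative[OF dg]] by blast
    then have "g' z = 0"
      by (metis mult_1)
    moreover have "z \<in> I"
      using that \<open>a < z\<close> \<open>z < b\<close> by (auto simp: I_def dist_real_def)
    ultimately show False using I by blast
  qed
  have "inj_on g I"
    by (intro linorder_inj_onI') (use noteq in auto)
  then obtain h where h: "homeomorphism I (g ` I) g h" and op: "open (g ` I)"
    using invariance_of_domain_homeomorphism[of I g] invariance_of_domain[OF contg, of I] contg
    by (auto simp: I_def)
  have "smooth_on (g ` I) h"
    by (rule smooth_on_inverse_fun[of I _ g h g'])
       (use h op dg I smooth in \<open>auto simp: I_def homeomorphism_def intro: smooth_on_subset\<close>)
  then show thesis
    using that[of I h] h op e(1) by (auto simp: I_def homeomorphism_def)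
qed

section \<open>Velocities of curves and tangent spaces\<close>

lemma has_vector_derivative_nth:
  "(c has_vector_derivative v) F \<Longrightarrow> ((\<lambda>s. c s $ j) has_vector_derivative v $ j) F"
  by (rule bounded_linear.has_vector_derivative[OF bounded_linear_vec_nth])

lemma has_vector_derivative_vecI:
  fixes c :: "real \<Rightarrow> real ^ 'n"
  assumes "\<And>j. ((\<lambda>s. c s $ j) has_vector_derivative v $ j) (at x)"
  shows "(c has_vector_derivative v) (at x)"
proof -
  have "((\<lambda>s. \<Sum>j\<in>UNIV. c s $ j *\<^sub>R axis j (1::real)) has_vector_derivative
      (\<Sum>j\<in>UNIV. v $ j *\<^sub>R axis j 1)) (at x)"
    by (intro has_vector_derivative_sum bounded_linear.has_vector_derivative[OF bounded_linear_scaleR_left] assms)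
  moreover have "(\<Sum>j\<in>UNIV. y $ j *\<^sub>R axis j (1::real)) = y" for y :: "real ^ 'n"
    by (auto simp: vec_eq_iff axis_def if_distrib cong: if_cong)
  ultimately show ?thesis by simp
qed

lemma has_vector_derivative_eq_on_open:
  assumes "(c has_vector_derivative v) (at x)" "(d has_vector_derivative w) (at x)"
    "open S" "x \<in> S" "\<And>s. s \<in> S \<Longrightarrow> c s = d s"
  shows "v = w"
  using assms has_vector_derivative_transform_within_open vector_derivative_unique_at by metis

lemma smooth_on_imp_has_vector_derivative:
  fixes c :: "real \<Rightarrow> 'a::real_normed_vector"
  assumes "smooth_on S c" "x \<in> S"
  obtains v where "(c has_vector_derivative v) (at x)"
proof -
  have "c differentiable at x"
    using assms unfolding smooth_on_def by (metis Ck_on.simps(2))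
  then show ?thesis
    using that vector_derivative_works by blast
qed

text \<open>Straight lines realise every velocity. With this,
  \<open>regular_value UNIV UNIV f 0\<close> amounts to surjectivity of the derivative at the zeros
  of \<open>f\<close>.\<close>

lemma tangent_space_UNIV [simp]: "tangent_space UNIV y = UNIV"
proof -
  have "\<exists>c. \<exists>e>0. smooth_on {-e<..<e} c \<and> c ` {-e<..<e} \<subseteq> UNIV \<and> c 0 = y \<and>
      (c has_vector_derivative v) (at (0::real))" for v
    by (intro exI[of _ "\<lambda>s. y + s *\<^sub>R v"] exI[of _ 1])
       (auto intro!: smooth_on_add smooth_on_scaleR smooth_on_id derivative_eq_intros)
  then show ?thesis by (auto simp: tangent_space_def)
qed

text \<open>Differentiate \<open>c s \<bullet> c s = 1\<close> along a curve on the sphere.\<close>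

lemma tangent_space_sphere:
  assumes "v \<in> tangent_space (sphere 0 1) u"
  shows "u \<bullet> v = 0"
proof -
  obtain c e where c: "e > 0" "c ` {-e<..<e} \<subseteq> sphere 0 1" "c 0 = u"
    "(c has_vector_derivative v) (at (0::real))"
    using assms by (auto simp: tangent_space_def)
  have "((\<lambda>s. c s \<bullet> c s) has_vector_derivative (u \<bullet> v + v \<bullet> u)) (at 0)"
    using bounded_bilinear.has_vector_derivative[OF bounded_bilinear_inner c(4) c(4)] c(3) by simp
  moreover have "((\<lambda>s. 1::real) has_vector_derivative 0) (at 0)"
    by simp
  ultimately have "u \<bullet> v + v \<bullet> u = 0"
  proof (rule has_vector_derivative_eq_on_open[where S = "{-e<..<e}"])
    show "c s \<bullet> c s = 1" if "s \<in> {-e<..<e}" for s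
    proof -
      have "c s \<in> sphere 0 1"
        using c(2) that by blast
      then show ?thesis by (simp add: norm_eq_1)
    qed
  qed (use c(1) in auto)
  then show ?thesis by (simp add: inner_commute)
qed

definition set_coord :: "'n \<Rightarrow> real ^ 'n \<Rightarrow> real \<Rightarrow> real ^ 'n" where
  "set_coord i y r = (\<chi> j. if j = i then r else y $ j)"

lemma set_coord_nth [simp]: "set_coord i y r $ j = (if j = i then r else y $ j)"
  by (simp add: set_coord_def)

lemma smooth_on_set_coord:
  assumes "open S" "smooth_on S y" "smooth_on S r"
  shows "smooth_on S (\<lambda>x. set_coord i (y x) (r x))"
proof (rule smooth_on_vecI[OF assms(1)])
  show "smooth_on S (\<lambda>x. set_coord i (y x) (r x) $ j)" for j
    using assms smooth_on_nth by (cases "j = i") auto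
qed

section \<open>Level sets of separable functions\<close>

lemma powr_minus_half: "x > 0 \<Longrightarrow> x powr (- (1 / 2)) = inverse (sqrt x)" for x :: real
  using powr_minus[of x "1/2"] by (simp add: powr_half_sqrt)

lemma gauss_map_eq_snd: "gauss_map = snd"
  by (auto simp: gauss_map_def)

text \<open>The maximum over the closed interval is at least \<open>g q\<close>, which exceeds both
  end values, so it is attained in the interior.\<close>

lemma critical_point_of_peak:
  fixes g g' :: "real \<Rightarrow> real"
  assumes dg: "\<And>t. (g has_real_derivative g' t) (at t)"
    and "a < q" "q < b" "g a < g q" "g b < g q"
  shows "\<exists>p. a < p \<and> p < b \<and> g' p = 0 \<and> g q \<le> g p"
proof -
  have "continuous_on {a..b} g"
    using dg by (meson DERIV_isCont continuous_at_imp_continuous_on)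
  then obtain p where p: "p \<in> {a..b}" "\<And>t. t \<in> {a..b} \<Longrightarrow> g t \<le> g p"
    using continuous_attains_sup[of "{a..b}" g] assms(2,3) by auto
  have "g q \<le> g p"
    using p(2) assms(2,3) by simp
  then have ab: "a < p" "p < b"
    using p(1) assms(4,5) by (auto simp: less_le)
  have "g' p = 0"
    by (rule DERIV_local_max[OF dg, of "min (p - a) (b - p)"]) (use ab p(2) in \<open>auto simp: abs_less_iff\<close>)
  then show ?thesis
    using ab \<open>g q \<le> g p\<close> by blast
qed

text \<open>The assumption \<open>regular\<close> makes \<open>0\<close> a regular value and the
  level set a hypersurface; \<open>morse\<close> makes the coordinate axes regular values of the
  Gauss map. Generic parameters secure both when the locale is interpreted.\<close>

locale separable_level =
  fixes g g' g'' :: "real \<Rightarrow> real" and c0 :: real and f :: "real ^ 'n \<Rightarrow> real" and V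
  assumes smooth_g: "smooth_on UNIV g"
    and dg: "(g has_real_derivative g' t) (at t)"
    and dg': "(g' has_real_derivative g'' t) (at t)"
    and morse: "g' t = 0 \<Longrightarrow> g'' t \<noteq> 0"
    and f_eq: "f x = c0 + (\<Sum>i\<in>UNIV. g (x $ i))"
    and V_eq: "V = {x. f x = 0}"
    and regular: "x \<in> V \<Longrightarrow> \<exists>i. g' (x $ i) \<noteq> 0"
begin

definition grad :: "real ^ 'n \<Rightarrow> real ^ 'n" where
  "grad x = (\<chi> i. g' (x $ i))"

lemma grad_nth [simp]: "grad x $ i = g' (x $ i)"
  by (simp add: grad_def)

lemma grad_nonzero: "x \<in> V \<Longrightarrow> grad x \<noteq> 0"
  using regular[of x] by (auto simp: vec_eq_iff)

section \<open>Regularity and charts of the level set\<close>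

lemma f_has_derivative: "(f has_derivative (\<lambda>v. grad x \<bullet> v)) (at x)"
proof -
  have "((\<lambda>x. c0 + (\<Sum>i\<in>UNIV. g (x $ i))) has_derivative (\<lambda>v. 0 + (\<Sum>i\<in>UNIV. v $ i * g' (x $ i)))) (at x)"
    by (intro has_derivative_add has_derivative_const has_derivative_sum
        has_derivative_compose[OF bounded_linear.has_derivative[OF bounded_linear_vec_nth]]
        has_real_derivative_imp_has_derivative dg has_derivative_ident)
  moreover have "f = (\<lambda>x. c0 + (\<Sum>i\<in>UNIV. g (x $ i)))"
    using f_eq by blast
  ultimately show ?thesis
    by (simp add: inner_vec_def mult.commute)
qed

lemma smooth_nth_compose: "smooth_on UNIV h \<Longrightarrow> smooth_on UNIV (\<lambda>x::real ^ 'n. h (x $ i))"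
  for h :: "real \<Rightarrow> real"
  by (rule smooth_on_compose[where T = UNIV and f = "\<lambda>x. x $ i"]) (simp_all add: smooth_on_nth smooth_on_id)

lemma smooth_f: "smooth_on UNIV f"
proof -
  have "smooth_on UNIV (\<lambda>x::real ^ 'n. c0 + (\<Sum>i\<in>UNIV. g (x $ i)))"
    by (intro smooth_on_add smooth_on_sum smooth_nth_compose smooth_g) auto
  then show ?thesis
    using f_eq by presburger
qed

lemma smooth_grad: "smooth_on UNIV grad"
  by (rule smooth_on_vecI)
     (use smooth_on_deriv[OF smooth_g _ dg] in \<open>auto intro: smooth_nth_compose\<close>)

lemma continuous_f: "continuous_on A f"
  using f_has_derivative has_derivative_continuous continuous_at_imp_continuous_on by blast

lemma regular_value_f: "regular_value UNIV UNIV f 0"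
proof -
  have "range (\<lambda>v. grad x \<bullet> v) = UNIV" if "f x = 0" for x
  proof -
    have "grad x \<bullet> grad x \<noteq> 0"
      using that grad_nonzero V_eq by auto
    then have "r = grad x \<bullet> ((r / (grad x \<bullet> grad x)) *\<^sub>R grad x)" for r
      by simp
    then show ?thesis by blast
  qed
  moreover have "f differentiable at x" for x
    using f_has_derivative unfolding differentiable_def by blast
  ultimately show ?thesis
    using frechet_derivative_eqI[OF f_has_derivative] by (auto simp: regular_value_def)
qed

text \<open>Because \<open>f\<close> is separable, replacing one coordinate by \<open>f\<close> is a chart whose inverse only needs
  a local inverse of the one-variable function \<open>g\<close>.\<close>

lemma chart:
  assumes "x \<in> V" "g' (x $ i) \<noteq> 0"
  obtains U W \<psi> where "open U" "x \<in> U" "open W" "homeomorphism U W (\<lambda>y. set_coord i y (f y)) \<psi>"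
    "smooth_on W \<psi>" "(\<lambda>y. set_coord i y (f y)) ` (U \<inter> V) = {y \<in> W. axis i 1 \<bullet> y = 0}"
    "\<And>y j. j \<noteq> i \<Longrightarrow> \<psi> y $ j = y $ j"
proof -
  obtain I h where I: "open I" "x $ i \<in> I" "open (g ` I)" "smooth_on (g ` I) h"
    and h: "\<And>t. t \<in> I \<Longrightarrow> h (g t) = t"
    using local_smooth_inverse[OF smooth_g dg assms(2)] by metis
  \<comment> \<open>\<open>R\<close> is the part of \<open>f\<close> that is independent of
    coordinate \<open>i\<close>. Hence giving \<open>f\<close> the value \<open>r\<close> by
    changing that coordinate means solving \<open>g t = r - R y\<close>, which \<open>h\<close>
    does; \<open>W\<close> collects the points where a solution in \<open>I\<close> exists.\<close>
  define R where "R y = f y - g (y $ i)" for y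
  have "R y = c0 + (\<Sum>j\<in>UNIV - {i}. g (y $ j))" for y
    by (simp add: R_def f_eq sum.remove[of UNIV i])
  then have R: "R (set_coord i y r) = R y" for y r
    by simp
  have f_set: "f (set_coord i y r) = R y + g r" for y r
    using R[of y r] by (simp add: R_def)
  define \<phi> where "\<phi> y = set_coord i y (f y)" for y
  define \<psi> where "\<psi> y = set_coord i y (h (y $ i - R y))" for y
  define U where "U = {y::real ^ 'n. y $ i \<in> I}"
  define W where "W = {y. y $ i - R y \<in> g ` I}"
  have smooth_R: "smooth_on UNIV R"
    unfolding R_def by (intro smooth_on_diff smooth_f smooth_nth_compose smooth_g) simp
  have smooth_coord: "smooth_on UNIV (\<lambda>y. y $ i - R y)"
    by (intro smooth_on_diff smooth_R smooth_on_nth smooth_on_id) auto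
  then have "continuous_on UNIV (\<lambda>y. y $ i - R y)"
    unfolding smooth_on_def by (metis Ck_on.simps(1))
  then have "open W"
    unfolding W_def using I(3) by (simp add: continuous_on_open_vimage vimage_def)
  have "open U"
    unfolding U_def using I(1) continuous_on_open_vimage[of UNIV "\<lambda>y::real ^ 'n. y $ i"]
    by (simp add: vimage_def continuous_on_component continuous_on_id)
  have smooth_\<psi>: "smooth_on W \<psi>"
    unfolding \<psi>_def
    by (intro smooth_on_set_coord smooth_on_id \<open>open W\<close>
        smooth_on_compose[OF I(4) smooth_on_subset[OF smooth_coord]] I(3))
       (auto simp: W_def)
  have smooth_\<phi>: "smooth_on UNIV \<phi>"
    unfolding \<phi>_def by (intro smooth_on_set_coord smooth_on_id smooth_f) auto
  have \<psi>\<phi>: "\<psi> (\<phi> y) = y" if "y \<in> U" for y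
  proof -
    have "\<phi> y $ i - R (\<phi> y) = g (y $ i)"
      using R by (simp add: \<phi>_def R_def)
    then show ?thesis
      using that h by (simp add: \<psi>_def U_def vec_eq_iff) (simp add: \<phi>_def)
  qed
  have \<phi>W: "\<phi> y \<in> W" if "y \<in> U" for y
    using that R by (simp add: \<phi>_def W_def U_def) (simp add: R_def)
  have \<psi>U: "\<psi> y \<in> U" and \<phi>\<psi>: "\<phi> (\<psi> y) = y" if y: "y \<in> W" for y
  proof -
    obtain t where t: "t \<in> I" "y $ i - R y = g t"
      using y unfolding W_def by blast
    then show "\<psi> y \<in> U"
      using h by (simp add: \<psi>_def U_def)
    show "\<phi> (\<psi> y) = y"
      using t h by (simp add: \<phi>_def \<psi>_def f_set vec_eq_iff)
  qed
  have hom: "homeomorphism U W \<phi> \<psi>"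
    unfolding homeomorphism_def
    using \<psi>\<phi> \<phi>W \<psi>U \<phi>\<psi> smooth_on_subset[OF smooth_\<phi>, of U] smooth_\<psi>
    unfolding smooth_on_def by (metis (no_types, lifting) Ck_on.simps(1) image_subset_iff image_eqI subsetI subset_antisym top_greatest)
  have img: "\<phi> ` (U \<inter> V) = {y \<in> W. axis i 1 \<bullet> y = 0}"
  proof -
    have "axis i 1 \<bullet> \<phi> y = f y" for y
      by (simp add: inner_axis' \<phi>_def)
    then show ?thesis
      using \<phi>W \<phi>\<psi> \<psi>U V_eq by (auto intro!: image_eqI) metis+
  qed
  have \<phi>_eq: "\<phi> = (\<lambda>y. set_coord i y (f y))"
    by (simp add: \<phi>_def fun_eq_iff)
  show thesis
  proof (rule that[of U W \<psi>])
    show "x \<in> U"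
      using I(2) by (simp add: U_def)
    show "\<psi> y $ j = y $ j" if "j \<noteq> i" for y j
      using that by (simp add: \<psi>_def)
  qed (use \<open>open U\<close> \<open>open W\<close> smooth_\<psi> hom img in \<open>simp_all only: \<phi>_eq\<close>)
qed

lemma smooth_hypersurface_V: "smooth_hypersurface V"
  unfolding smooth_hypersurface_def
proof
  fix p assume "p \<in> V"
  then obtain i where "g' (p $ i) \<noteq> 0"
    using regular by blast
  then obtain U W \<psi> where chart: "open U" "p \<in> U" "open W"
    "homeomorphism U W (\<lambda>y. set_coord i y (f y)) \<psi>" "smooth_on W \<psi>"
    "(\<lambda>y. set_coord i y (f y)) ` (U \<inter> V) = {y \<in> W. axis i 1 \<bullet> y = 0}"
    "\<And>y j. j \<noteq> i \<Longrightarrow> \<psi> y $ j = y $ j"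
    by (rule chart[OF \<open>p \<in> V\<close>]) (rule that)
  moreover have "smooth_on U (\<lambda>y. set_coord i y (f y))"
    using chart(1) smooth_on_subset[OF smooth_f] by (intro smooth_on_set_coord smooth_on_id) auto
  moreover have "axis i (1::real) \<noteq> 0"
    by (simp add: axis_eq_0_iff)
  ultimately show "\<exists>U W \<phi> \<psi>. \<exists>h::real ^ 'n. open U \<and> p \<in> U \<and> open W \<and> homeomorphism U W \<phi> \<psi> \<and>
      smooth_on U \<phi> \<and> smooth_on W \<psi> \<and> h \<noteq> 0 \<and> \<phi> ` (U \<inter> V) = {y \<in> W. h \<bullet> y = 0}"
    by blast
qed

section \<open>Tangent spaces and unit normals of the level set\<close>

lemma velocity_orthogonal_grad:
  assumes "e > 0" "c ` {-e<..<e} \<subseteq> V" "c 0 = x" "(c has_vector_derivative v) (at (0::real))"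
  shows "grad x \<bullet> v = 0"
proof -
  have "((\<lambda>s. f (c s)) has_derivative (\<lambda>s. grad x \<bullet> (s *\<^sub>R v))) (at 0)"
    using has_derivative_compose[OF assms(4)[unfolded has_vector_derivative_def], of f "\<lambda>v. grad x \<bullet> v"]
      f_has_derivative assms(3) by simp
  then have "((\<lambda>s. f (c s)) has_vector_derivative grad x \<bullet> v) (at 0)"
    by (simp add: has_vector_derivative_def)
  moreover have "((\<lambda>s. 0::real) has_vector_derivative 0) (at 0)"
    by simp
  ultimately show ?thesis
    by (rule has_vector_derivative_eq_on_open[where S = "{-e<..<e}"]) (use assms V_eq in \<open>auto simp: image_subset_iff\<close>)
qed

text \<open>The curve is a straight line in the chart, pulled back to \<open>V\<close>. The chart
  fixes all coordinates but \<open>i\<close>, so the velocity agrees with \<open>w\<close> there; at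
  \<open>i\<close> it agrees because both are orthogonal to \<open>grad x\<close>, whose entry at
  \<open>i\<close> is nonzero.\<close>

lemma curve_exists:
  assumes "x \<in> V" "grad x \<bullet> w = 0"
  shows "\<exists>c. \<exists>e>0. smooth_on {-e<..<e} c \<and> c ` {-e<..<e} \<subseteq> V \<and> c 0 = x \<and>
     (c has_vector_derivative w) (at (0::real))"
proof -
  obtain i where i: "g' (x $ i) \<noteq> 0"
    using regular assms(1) by blast
  let ?\<phi> = "\<lambda>y. set_coord i y (f y)"
  obtain U W \<psi> where chart: "open U" "x \<in> U" "open W"
    "homeomorphism U W ?\<phi> \<psi>" "smooth_on W \<psi>"
    "?\<phi> ` (U \<inter> V) = {y \<in> W. axis i 1 \<bullet> y = 0}" and \<psi>: "\<And>y j. j \<noteq> i \<Longrightarrow> \<psi> y $ j = y $ j"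
    by (rule chart[OF assms(1) i]) (rule that)
  \<comment> \<open>Setting entry \<open>i\<close> of the direction to \<open>0\<close> keeps the
    line in the hyperplane that represents \<open>V\<close> in the chart.\<close>
  define l where "l s = ?\<phi> x + s *\<^sub>R set_coord i w 0" for s
  define c where "c s = \<psi> (l s)" for s
  have smooth_l: "smooth_on UNIV l"
    unfolding l_def by (intro smooth_on_add smooth_on_scaleR smooth_on_id) auto
  then have "continuous_on UNIV l"
    unfolding smooth_on_def by (metis Ck_on.simps(1))
  then have "open (l -` W)"
    using chart(3) by (simp add: continuous_on_open_vimage)
  moreover have "?\<phi> x \<in> W"
    using chart(2,4) by (auto simp: homeomorphism_def)
  then have "0 \<in> l -` W"
    by (simp add: l_def)
  ultimately obtain e where e: "e > 0" "ball 0 e \<subseteq> l -` W"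
    using open_contains_ball_eq by blast
  then have lW: "l s \<in> W" if "s \<in> {-e<..<e}" for s
    using that by (auto simp: subset_eq dist_real_def)
  have smooth_c: "smooth_on {-e<..<e} c"
    unfolding c_def
    by (rule smooth_on_compose[OF chart(5) smooth_on_subset[OF smooth_l]]) (use chart(3) lW in auto)
  have cV: "c s \<in> V" if "s \<in> {-e<..<e}" for s
  proof -
    have "axis i 1 \<bullet> l s = 0"
      using assms(1) V_eq by (simp add: l_def inner_axis')
    then have "l s \<in> ?\<phi> ` (U \<inter> V)"
      using lW[OF that] chart(6) by blast
    then show ?thesis
      using chart(4) by (auto simp: c_def homeomorphism_def)
  qed
  have c0: "c 0 = x"
    using chart(2,4) by (simp add: c_def l_def homeomorphism_def)
  obtain u where u: "(c has_vector_derivative u) (at 0)"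
    using smooth_on_imp_has_vector_derivative[OF smooth_c, of 0] e(1) by auto
  have u_nth: "u $ j = w $ j" if "j \<noteq> i" for j
  proof (rule has_vector_derivative_eq_on_open[OF has_vector_derivative_nth[OF u], of "\<lambda>s. x $ j + s * w $ j" _ UNIV])
    show "((\<lambda>s. x $ j + s * w $ j) has_vector_derivative w $ j) (at 0)"
      by (auto intro!: derivative_eq_intros)
    show "c s $ j = x $ j + s * w $ j" for s
      using that \<psi> by (simp add: c_def l_def)
  qed auto
  have "grad x \<bullet> u = 0"
    using velocity_orthogonal_grad[OF e(1) _ c0 u] cV by blast
  then have "grad x \<bullet> (u - w) = 0"
    using assms(2) by (simp add: inner_diff_right)
  moreover have "grad x \<bullet> (u - w) = g' (x $ i) * (u $ i - w $ i)"
    using u_nth by (simp add: inner_vec_def sum.remove[of UNIV i])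
  ultimately have "u = w"
    using i u_nth by (auto simp: vec_eq_iff) metis
  then show ?thesis
    using e(1) smooth_c cV c0 u by blast
qed

lemma tangent_space_V: "x \<in> V \<Longrightarrow> tangent_space V x = {w. grad x \<bullet> w = 0}"
proof (intro subset_antisym subsetI)
  fix w assume "w \<in> tangent_space V x"
  then show "w \<in> {w. grad x \<bullet> w = 0}"
    unfolding tangent_space_def by (auto intro: velocity_orthogonal_grad)
next
  fix w assume "x \<in> V" "w \<in> {w. grad x \<bullet> w = 0}"
  then show "w \<in> tangent_space V x"
    unfolding tangent_space_def using curve_exists by simp
qed

lemma unit_normal_bundle_scaled_grad:
  assumes "x \<in> V" "u = r *\<^sub>R grad x" "norm u = 1"
  shows "(x, u) \<in> unit_normal_bundle V"
  using assms tangent_space_V[OF assms(1)] by (auto simp: unit_normal_bundle_def orthogonal_def)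

lemma unit_normal_bundle_axis:
  "(x, axis i 1) \<in> unit_normal_bundle V \<longleftrightarrow> x \<in> V \<and> (\<forall>j. j \<noteq> i \<longrightarrow> g' (x $ j) = 0)"
proof (intro iffI conjI allI impI)
  assume *: "(x, axis i 1) \<in> unit_normal_bundle V"
  then show V: "x \<in> V" by (simp add: unit_normal_bundle_def)
  fix j assume "j \<noteq> i"
  \<comment> \<open>This is the part of the gradient in the plane of the axes \<open>i\<close> and
    \<open>j\<close>, turned by a right angle: a tangent vector whose entry at \<open>i\<close> is
    \<open>g' (x $ j)\<close>.\<close>
  define w where "w = g' (x $ j) *\<^sub>R axis i 1 - g' (x $ i) *\<^sub>R axis j (1::real)"
  have "grad x \<bullet> w = 0"
    by (simp add: w_def inner_diff_right inner_axis)
  then have "axis i 1 \<bullet> w = 0"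
    using * tangent_space_V[OF V] by (auto simp: unit_normal_bundle_def orthogonal_def)
  then have "w $ i = 0"
    by (simp add: inner_axis')
  then show "g' (x $ j) = 0"
    using \<open>j \<noteq> i\<close> by (simp add: w_def axis_def)
next
  assume *: "x \<in> V \<and> (\<forall>j. j \<noteq> i \<longrightarrow> g' (x $ j) = 0)"
  then have "g' (x $ i) \<noteq> 0"
    using regular by metis
  moreover have "grad x = g' (x $ i) *\<^sub>R axis i 1"
    using * by (simp add: vec_eq_iff axis_def)
  ultimately have "axis i 1 = inverse (g' (x $ i)) *\<^sub>R grad x"
    by simp
  then show "(x, axis i 1) \<in> unit_normal_bundle V"
    using * unit_normal_bundle_scaled_grad by (metis norm_axis_1)
qed


text \<open>The differential is the projection \<open>snd\<close>, so every \<open>v\<close> tangent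
  to the sphere must be the velocity of the normals along some curve in \<open>V\<close>. Normalised
  gradients serve as normals, and the diagonal Hessian can be inverted in all entries other than
  \<open>i\<close> by \<open>morse\<close>.\<close>

lemma regular_value_gauss_map:
  "regular_value (unit_normal_bundle V) (sphere 0 1) gauss_map (axis i 1)"
proof -
  let ?B = "unit_normal_bundle V"
  have der: "(gauss_map has_derivative snd) (at p)" for p :: "(real ^ 'n) \<times> (real ^ 'n)"
    unfolding gauss_map_eq_snd by (rule bounded_linear_imp_has_derivative[OF bounded_linear_snd])
  have "snd ` tangent_space ?B (x, axis i 1) = tangent_space (sphere 0 1) (axis i 1)"
    if "(x, axis i 1) \<in> ?B" for x
  proof (intro subset_antisym subsetI)
    fix v assume "v \<in> snd ` tangent_space ?B (x, axis i 1)"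
    then obtain c e where c: "e > 0" "smooth_on {-e<..<e} c" "c ` {-e<..<e} \<subseteq> ?B" "c 0 = (x, axis i 1)"
      and v: "((\<lambda>s. snd (c s)) has_vector_derivative v) (at (0::real))"
      unfolding tangent_space_def
      by (auto dest!: bounded_linear.has_vector_derivative[OF bounded_linear_snd])
    have "smooth_on {-e<..<e} (\<lambda>s. snd (c s))"
      using c(2) by (intro smooth_on_bounded_linear_compose[OF bounded_linear_snd]) auto
    moreover have "(\<lambda>s. snd (c s)) ` {-e<..<e} \<subseteq> sphere 0 1"
      using c(3) by (force simp: unit_normal_bundle_def)
    ultimately show "v \<in> tangent_space (sphere 0 1) (axis i 1)"
      using c v unfolding tangent_space_def by (intro CollectI exI[of _ "\<lambda>s. snd (c s)"] exI[of _ e]) auto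
  next
    fix v :: "real ^ 'n" assume "v \<in> tangent_space (sphere 0 1) (axis i 1)"
    then have vi: "v $ i = 0"
      using tangent_space_sphere[of v] by (force simp: inner_axis')
    have x: "x \<in> V" and crit: "\<And>j. j \<noteq> i \<Longrightarrow> g' (x $ j) = 0"
      using that unit_normal_bundle_axis by blast+
    define \<mu> where "\<mu> = g' (x $ i)"
    have \<mu>: "\<mu> \<noteq> 0"
      using regular[OF x] crit unfolding \<mu>_def by metis
    have grad_x: "grad x = \<mu> *\<^sub>R axis i 1"
      using crit by (simp add: vec_eq_iff axis_def \<mu>_def)
    \<comment> \<open>Along velocity \<open>w\<close> the gradient changes by
      \<open>g'' (x $ j) * w $ j\<close> in entry \<open>j\<close>, here
      \<open>\<mu> * v $ j\<close>. The divisors are nonzero for \<open>j \<noteq> i\<close> because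
      those coordinates are critical; the entry \<open>0\<close> at \<open>i\<close> makes
      \<open>w\<close> tangent and matches \<open>v $ i = 0\<close>.\<close>
    define w where "w = (\<chi> j. if j = i then 0 else \<mu> * v $ j / g'' (x $ j))"
    have "grad x \<bullet> w = 0"
      by (simp add: grad_x inner_axis' w_def)
    then obtain c e where c: "e > 0" "smooth_on {-e<..<e} c" "c ` {-e<..<e} \<subseteq> V" "c 0 = x"
      "(c has_vector_derivative w) (at (0::real))"
      using curve_exists[OF x] by blast
    define q where "q s = grad (c s)" for s
    \<comment> \<open>The factor that normalises the gradient. The sign selects the one of the two
      unit normals that is \<open>axis i 1\<close> at \<open>s = 0\<close>, rather than its
      negative.\<close>
    define r where "r s = sgn \<mu> * (q s \<bullet> q s) powr (- (1 / 2))" for s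
    have dq: "(q has_vector_derivative \<mu> *\<^sub>R v) (at 0)"
    proof (rule has_vector_derivative_vecI)
      fix j
      have dc: "((\<lambda>s. c s $ j) has_real_derivative w $ j) (at 0)"
        using has_vector_derivative_nth[OF c(5)] by (simp add: has_real_derivative_iff_has_vector_derivative)
      have "((\<lambda>s. g' (c s $ j)) has_real_derivative g'' (x $ j) * w $ j) (at 0)"
        using DERIV_chain2[OF dg' dc] c(4) by simp
      moreover have "g'' (x $ j) * w $ j = \<mu> * v $ j"
        using vi morse[OF crit, of j] by (simp add: w_def)
      ultimately show "((\<lambda>s. q s $ j) has_vector_derivative (\<mu> *\<^sub>R v) $ j) (at 0)"
        by (simp add: q_def has_real_derivative_iff_has_vector_derivative)
    qed
    have q0: "q 0 = \<mu> *\<^sub>R axis i 1"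
      by (simp add: q_def c(4) grad_x)
    have q0_sq: "q 0 \<bullet> q 0 = \<mu>\<^sup>2"
      by (simp add: q0 power2_eq_square)
    have r0: "r 0 = inverse \<mu>"
      using \<mu> by (auto simp: r_def q0_sq powr_minus_half sgn_if)
    \<comment> \<open>The squared length changes at rate
      \<open>2 * \<mu>\<^sup>2 * v $ i = 0\<close>, so to first order normalisation only rescales by
      \<open>inverse \<mu>\<close>, turning the velocity \<open>\<mu> *\<^sub>R v\<close> into
      \<open>v\<close>.\<close>
    have "((\<lambda>s. q s \<bullet> q s) has_real_derivative 0) (at 0)"
      using bounded_bilinear.has_vector_derivative[OF bounded_bilinear_inner dq dq] vi
      by (simp add: q0 inner_axis inner_axis' has_real_derivative_iff_has_vector_derivative)
    then have "(r has_real_derivative sgn \<mu> * ((- (1 / 2)) * (q 0 \<bullet> q 0) powr (- (1 / 2) - 1) * 0)) (at 0)"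
      unfolding r_def using \<mu>
      by (intro DERIV_cmult DERIV_chain2[where g = "\<lambda>s. q s \<bullet> q s"] has_real_derivative_powr)
         (auto simp: q0_sq)
    then have dr: "(r has_real_derivative 0) (at 0)"
      by simp
    have du: "((\<lambda>s. r s *\<^sub>R q s) has_vector_derivative v) (at 0)"
      using has_vector_derivative_scaleR[OF dr dq] \<mu> by (simp add: r0)
    have q_pos: "q s \<bullet> q s > 0" if "s \<in> {-e<..<e}" for s
      using c(3) that grad_nonzero[of "c s"] by (auto simp: q_def image_subset_iff)
    have smooth_q: "smooth_on {-e<..<e} q"
      unfolding q_def by (rule smooth_on_compose[OF smooth_grad c(2)]) auto
    have smooth_qn: "smooth_on {-e<..<e} (\<lambda>s. q s \<bullet> q s)"
      unfolding inner_vec_def using smooth_q by (intro smooth_on_sum) (auto intro!: smooth_on_mult smooth_on_nth)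
    have "smooth_on {-e<..<e} r"
      unfolding r_def using q_pos
      by (intro smooth_on_mult smooth_on_const smooth_on_compose[OF smooth_on_powr smooth_qn]) auto
    then have "smooth_on {-e<..<e} (\<lambda>s. (c s, r s *\<^sub>R q s))"
      using c(2) smooth_q by (intro smooth_on_Pair smooth_on_scaleR) auto
    moreover have "(c s, r s *\<^sub>R q s) \<in> ?B" if "s \<in> {-e<..<e}" for s
    proof (rule unit_normal_bundle_scaled_grad[where r = "r s"])
      show "c s \<in> V"
        using c(3) that by blast
      show "norm (r s *\<^sub>R q s) = 1"
        using q_pos[OF that] \<mu> by (simp add: r_def abs_mult powr_minus_half abs_sgn_eq flip: norm_eq_sqrt_inner)
    qed (simp add: q_def)
    moreover have "r 0 *\<^sub>R q 0 = axis i 1"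
      using \<mu> by (simp add: r0 q0)
    ultimately have "(w, v) \<in> tangent_space ?B (x, axis i 1)"
      unfolding tangent_space_def using c du
      by (intro CollectI exI[of _ "\<lambda>s. (c s, r s *\<^sub>R q s)"] exI[of _ e])
         (auto intro: has_vector_derivative_Pair)
    then show "v \<in> snd ` tangent_space ?B (x, axis i 1)"
      by force
  qed
  note image = this
  show ?thesis
    unfolding regular_value_def
  proof (intro conjI ballI impI)
    fix p assume p: "p \<in> ?B" "gauss_map p = axis i 1"
    show "gauss_map differentiable (at p)"
      using der unfolding differentiable_def by blast
    obtain x where x: "p = (x, axis i 1)"
      using p(2) by (cases p) (auto simp: gauss_map_def)
    show "frechet_derivative gauss_map (at p) ` tangent_space ?B p = tangent_space (sphere 0 1) (axis i 1)"
      unfolding frechet_derivative_eqI[OF der] x by (rule image) (use p(1) x in simp)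
  qed simp
qed

text \<open>The axis is a regular value, so the size of its fibre enters the supremum, and distinct
  \<open>x\<close> in \<open>X\<close> give distinct points \<open>(x, axis i 1)\<close> of that
  fibre.\<close>

lemma mdeg_ge:
  assumes "finite X" "\<And>x. x \<in> X \<Longrightarrow> x \<in> V" "\<And>x j. x \<in> X \<Longrightarrow> j \<noteq> i \<Longrightarrow> g' (x $ j) = 0"
  shows "enat (card X) \<le> mdeg V"
proof -
  let ?F = "{p \<in> unit_normal_bundle V. gauss_map p = axis i 1}"
  have sub: "(\<lambda>x. (x, axis i 1)) ` X \<subseteq> ?F"
    using assms unit_normal_bundle_axis by (auto simp: gauss_map_def)
  have "card X = card ((\<lambda>x. (x, axis i (1::real))) ` X)"
    by (rule card_image[symmetric]) (auto intro: inj_onI)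
  also have "enat \<dots> \<le> ecard ?F"
    using card_mono[OF _ sub] by (auto simp: ecard_def)
  also have "\<dots> \<le> mdeg V"
    unfolding mdeg_def by (rule SUP_upper) (use regular_value_gauss_map in auto)
  finally show ?thesis .
qed

lemma continuous_g: "continuous_on A g"
  using dg by (meson DERIV_isCont continuous_at_imp_continuous_on)

text \<open>If one coordinate exceeds \<open>B\<close> in absolute value, its summand is below
  \<open>\<delta>\<close> while the others are at most \<open>1 + \<delta>\<close>; this forces
  \<open>f x < 0\<close>. So the closed set \<open>V\<close> lies in a cube.\<close>

lemma compact_V:
  assumes upper: "\<And>t. g t \<le> 1 + \<delta>" and tail: "\<And>t. \<bar>t\<bar> > B \<Longrightarrow> g t < \<delta>"
    and "c0 + (real CARD('n) - 1) * (1 + \<delta>) + \<delta> \<le> 0"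
  shows "compact V"
proof -
  have "\<bar>x $ i\<bar> \<le> B" if "x \<in> V" for x i
  proof (rule ccontr)
    assume "\<not> \<bar>x $ i\<bar> \<le> B"
    then have "g (x $ i) < \<delta>"
      using tail by simp
    moreover have "(\<Sum>j\<in>UNIV - {i}. g (x $ j)) \<le> of_nat (card (UNIV - {i})) * (1 + \<delta>)"
      by (rule sum_bounded_above) (rule upper)
    moreover have "real (card (UNIV - {i})) = real CARD('n) - 1"
      by (simp add: card_Diff_singleton of_nat_diff Suc_leI)
    ultimately have "f x < 0"
      using assms(3) by (simp add: f_eq sum.remove[of UNIV i])
    then show False
      using that V_eq by simp
  qed
  then have "V \<subseteq> cbox (\<chi> i. - B) (\<chi> i. B)"
    by (auto simp: mem_box_cart abs_le_iff minus_le_iff)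
  then have "bounded V"
    using bounded_cbox bounded_subset by blast
  moreover have "closed V"
    unfolding V_eq by (intro closed_Collect_eq continuous_f continuous_on_const)
  ultimately show ?thesis
    by (simp add: compact_eq_bounded_closed)
qed

text \<open>The points of \<open>V\<close> whose normal is the \<open>i\<close>-th axis: away from \<open>i\<close>, every coordinate may be the
  critical point in any of the \<open>N\<close> peaks of \<open>g\<close>; then \<open>f = 0\<close> prescribes for \<open>g\<close> at coordinate \<open>i\<close>
  a value near \<open>1/2\<close>, which is taken on both flanks of every peak.\<close>

lemma mdeg_ge_peaks:
  assumes vq: "\<And>k. v k < q k" "\<And>k. q k < v (Suc k)"
    and valley: "\<And>k. k \<le> N \<Longrightarrow> g (v k) < \<delta>" and peak: "\<And>k. k < N \<Longrightarrow> g (q k) > 1 - \<delta>"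
    and upper: "\<And>t. g t \<le> 1 + \<delta>"
    and c0: "\<bar>c0 + (real CARD('n) - 1 / 2)\<bar> < \<delta>" and \<delta>: "(real CARD('n) + 1) * \<delta> \<le> 1 / 2"
  shows "enat (2 * N ^ CARD('n)) \<le> mdeg V"
proof -
  \<comment> \<open>An arbitrary coordinate; by symmetry all axes give the same count.\<close>
  define i :: 'n where "i = undefined"
  have n: "real CARD('n) \<ge> 1"
    by (simp add: Suc_leI)
  have "\<delta> > 0"
    using c0 by linarith
  then have "1 * \<delta> \<le> real CARD('n) * \<delta>"
    using n by (intro mult_right_mono) auto
  moreover have "real CARD('n) * \<delta> + \<delta> \<le> 1 / 2"
    using \<delta> by (simp add: distrib_right)
  ultimately have \<delta>_half: "\<delta> < 1 / 2"
    using \<open>\<delta> > 0\<close> by linarith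
  have "mono v"
    using vq by (intro incseq_SucI) (meson less_trans less_imp_le)
  \<comment> \<open>The intervals between consecutive valleys are disjoint, so a point in one of
    them determines the index of its peak.\<close>
  have same: "k = l" if "v k < t" "t < v (Suc k)" "v l < t" "t < v (Suc l)" for k l t
  proof (rule ccontr)
    assume "k \<noteq> l"
    then have "Suc k \<le> l \<or> Suc l \<le> k" by linarith
    then have "v (Suc k) \<le> v l \<or> v (Suc l) \<le> v k"
      using \<open>mono v\<close> by (auto dest: monoD)
    then show False using that by linarith
  qed
  have "\<exists>p. v k < p \<and> p < v (Suc k) \<and> g' p = 0 \<and> g (q k) \<le> g p" if "k < N" for k
    by (rule critical_point_of_peak[OF dg vq])
       (use valley[of k] valley[of "Suc k"] peak[of k] that \<delta>_half in auto)
  then obtain p where p: "v k < p k" "p k < v (Suc k)" "g' (p k) = 0" "g (q k) \<le> g (p k)" if "k < N" for k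
    by metis
  \<comment> \<open>The flag \<open>b\<close> selects the rising or the falling flank. The
    inequalities are strict since \<open>g\<close> is below \<open>\<delta>\<close> at valleys and
    above \<open>1 - \<delta>\<close> at peaks.\<close>
  have T_ex: "\<exists>t. g t = y \<and> (if b then v k < t \<and> t < q k else q k < t \<and> t < v (Suc k))"
    if "k < N" "\<delta> \<le> y" "y \<le> 1 - \<delta>" for k b y
  proof (cases b)
    case True
    have "\<exists>t\<ge>v k. t \<le> q k \<and> g t = y"
      by (rule IVT'[OF _ _ _ continuous_g]) (use vq(1)[of k] valley[of k] peak[of k] that in linarith)+
    then obtain t where "v k \<le> t" "t \<le> q k" "g t = y"
      by blast
    moreover from this have "t \<noteq> v k" "t \<noteq> q k"
      using valley[of k] peak[of k] that by auto
    ultimately show ?thesis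
      using True by (auto simp: less_le)
  next
    case False
    have "\<exists>t\<ge>q k. t \<le> v (Suc k) \<and> g t = y"
      by (rule IVT2'[OF _ _ _ continuous_g])
         (use vq(2)[of k] valley[of "Suc k"] peak[of k] that in \<open>simp_all add: Suc_le_eq\<close>)
    then obtain t where "q k \<le> t" "t \<le> v (Suc k)" "g t = y"
      by blast
    moreover from this have "t \<noteq> q k" "t \<noteq> v (Suc k)"
      using valley[of "Suc k"] peak[of k] that by auto
    ultimately show ?thesis
      using False by (auto simp: less_le)
  qed
  define T where "T k b y = (SOME t. g t = y \<and> (if b then v k < t \<and> t < q k else q k < t \<and> t < v (Suc k)))"
    for k b y
  have T: "g (T k b y) = y"
      "if b then v k < T k b y \<and> T k b y < q k else q k < T k b y \<and> T k b y < v (Suc k)"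
    if "k < N" "\<delta> \<le> y" "y \<le> 1 - \<delta>" for k b y
    using someI_ex[OF T_ex[OF that, of b]] unfolding T_def by blast+
  have T_in: "v k < T k b y" "T k b y < v (Suc k)" "T k b y < q k \<longleftrightarrow> b"
    if "k < N" "\<delta> \<le> y" "y \<le> 1 - \<delta>" for k b y
    using T(2)[OF that, of b] vq[of k] by (auto split: if_splits)
  \<comment> \<open>The value that \<open>g\<close> must take at coordinate \<open>i\<close> for
    \<open>f\<close> to vanish once the other coordinates sit at the critical points chosen by
    \<open>\<kappa>\<close>.\<close>
  define y where "y \<kappa> = - c0 - (\<Sum>j\<in>UNIV - {i}. g (p (\<kappa> j)))" for \<kappa> :: "'n \<Rightarrow> nat"
  define \<Phi> where "\<Phi> = (\<lambda>(\<kappa>, b). set_coord i (\<chi> j. p (\<kappa> j)) (T (\<kappa> i) b (y \<kappa>)))"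
  define K where "K = (PiE (UNIV :: 'n set) (\<lambda>_. {..<N})) \<times> (UNIV :: bool set)"
  have \<kappa>N: "\<kappa> j < N" if "(\<kappa>, b) \<in> K" for \<kappa> b j
    using that by (auto simp: K_def)
  \<comment> \<open>Each of the \<open>CARD('n) - 1\<close> critical values is within
    \<open>\<delta>\<close> of \<open>1\<close>, and \<open>c0\<close> is within
    \<open>\<delta>\<close> of its target. So \<open>y \<kappa>\<close> is within
    \<open>CARD('n) * \<delta>\<close> of \<open>1 / 2\<close>, and the bound on
    \<open>\<delta>\<close> leaves a margin of \<open>\<delta>\<close> on either side.\<close>
  have y: "\<delta> \<le> y \<kappa>" "y \<kappa> \<le> 1 - \<delta>" if "(\<kappa>, b) \<in> K" for \<kappa> b
  proof -
    have card: "real (card (UNIV - {i})) = real CARD('n) - 1"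
      by (simp add: card_Diff_singleton of_nat_diff Suc_leI)
    have "(\<Sum>j\<in>UNIV - {i}. g (p (\<kappa> j))) \<le> of_nat (card (UNIV - {i})) * (1 + \<delta>)"
      by (rule sum_bounded_above) (rule upper)
    moreover have "of_nat (card (UNIV - {i})) * (1 - \<delta>) \<le> (\<Sum>j\<in>UNIV - {i}. g (p (\<kappa> j)))"
    proof (rule sum_bounded_below)
      show "1 - \<delta> \<le> g (p (\<kappa> j))" for j
        using p(4)[of "\<kappa> j"] peak[of "\<kappa> j"] \<kappa>N[OF that] by (meson less_imp_le order_trans)
    qed
    ultimately show "\<delta> \<le> y \<kappa>" "y \<kappa> \<le> 1 - \<delta>"
      using c0 \<delta> unfolding card y_def by (auto simp: algebra_simps abs_less_iff)
  qed
  \<comment> \<open>A point reveals \<open>\<kappa>\<close> through the intervals containing its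
    coordinates, and then \<open>b\<close> through the side of \<open>q (\<kappa> i)\<close> on
    which coordinate \<open>i\<close> lies.\<close>
  have "inj_on \<Phi> K"
  proof (rule inj_onI)
    fix z z' assume z: "z \<in> K" "z' \<in> K" "\<Phi> z = \<Phi> z'"
    obtain \<kappa> b \<kappa>' b' where zs: "z = (\<kappa>, b)" "z' = (\<kappa>', b')"
      by (metis prod.exhaust)
    note in_K = z(1,2)[unfolded zs]
    have nth: "\<Phi> z $ j = \<Phi> z' $ j" for j
      using z(3) by simp
    have off: "\<kappa> j = \<kappa>' j" if "j \<noteq> i" for j
      using nth[of j] that p(1,2)[OF \<kappa>N[OF in_K(1)], of j] p(1,2)[OF \<kappa>N[OF in_K(2)], of j]
      by (intro same[of _ "p (\<kappa> j)"]) (simp_all add: \<Phi>_def zs)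
    have Teq: "T (\<kappa> i) b (y \<kappa>) = T (\<kappa>' i) b' (y \<kappa>')"
      using nth[of i] by (simp add: \<Phi>_def zs)
    note T1 = T_in[OF \<kappa>N[OF in_K(1), of i] y[OF in_K(1)], of b]
    note T2 = T_in[OF \<kappa>N[OF in_K(2), of i] y[OF in_K(2)], of b', folded Teq]
    have "\<kappa> i = \<kappa>' i"
      by (rule same[OF T1(1,2) T2(1,2)])
    then have "\<kappa> = \<kappa>'"
      using off by (metis ext)
    then show "z = z'"
      using T1(3) T2(3) zs by simp
  qed
  then have "card (\<Phi> ` K) = 2 * N ^ CARD('n)"
    by (simp add: card_image K_def card_cartesian_product card_PiE)
  moreover have "enat (card (\<Phi> ` K)) \<le> mdeg V"
  proof (rule mdeg_ge[where i = i])
    show "finite (\<Phi> ` K)"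
      unfolding K_def by (intro finite_imageI finite_cartesian_product finite_PiE) auto
    fix x assume "x \<in> \<Phi> ` K"
    then obtain \<kappa> b where in_K: "(\<kappa>, b) \<in> K" and x: "x = set_coord i (\<chi> j. p (\<kappa> j)) (T (\<kappa> i) b (y \<kappa>))"
      by (auto simp: \<Phi>_def)
    have "f x = c0 + (y \<kappa> + (\<Sum>j\<in>UNIV - {i}. g (p (\<kappa> j))))"
      using T(1)[OF \<kappa>N[OF in_K] y[OF in_K]] by (simp add: f_eq x sum.remove[of UNIV i])
    then show "x \<in> V"
      by (simp add: V_eq y_def)
    show "g' (x $ j) = 0" if "j \<noteq> i" for j
      using that p(3)[OF \<kappa>N[OF in_K]] by (simp add: x)
  qed
  ultimately show ?thesis by simp
qed

end

section \<open>A sigmoid network with many peaks\<close>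

lemma logistic_pos: "0 < logistic u" and logistic_less_1: "logistic u < 1"
  unfolding logistic_def by (simp_all add: add_pos_pos inverse_less_1_iff)

definition logistic' :: "real \<Rightarrow> real" where
  "logistic' u = logistic u * (1 - logistic u)"

definition logistic'' :: "real \<Rightarrow> real" where
  "logistic'' u = logistic' u * (1 - 2 * logistic u)"

lemma DERIV_logistic: "(logistic has_real_derivative logistic' u) (at u)"
proof -
  have "1 + exp (- u) \<noteq> 0"
    by (metis add_pos_pos exp_gt_zero less_irrefl zero_less_one)
  then show ?thesis
    unfolding logistic_def logistic'_def
    by (auto intro!: derivative_eq_intros simp: divide_simps power2_eq_square)
qed

lemma DERIV_logistic': "(logistic' has_real_derivative logistic'' u) (at u)"
  unfolding logistic'_def
  by (auto intro!: derivative_eq_intros DERIV_logistic simp: logistic''_def logistic'_def algebra_simps)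

lemma logistic'_pos: "0 < logistic' u"
  using logistic_pos logistic_less_1 by (simp add: logistic'_def)

lemma logistic_mono: "u \<le> v \<Longrightarrow> logistic u \<le> logistic v"
  unfolding logistic_def by (intro le_imp_inverse_le) (auto intro: add_pos_pos)

text \<open>The logistic function solves \<open>s' = s * (1 - s)\<close>, so polynomials in it are
  closed under differentiation; \<open>[:0, 1, - 1:]\<close> is the right-hand side of this
  equation.\<close>

lemma smooth_on_logistic: "smooth_on UNIV logistic"
proof (rule smooth_on_real_family[where P = "{\<lambda>x. poly p (logistic x) | p. True}"])
  show "logistic \<in> {\<lambda>x. poly p (logistic x) | p. True}"
    by (rule CollectI, rule exI[of _ "[:0, 1:]"]) auto
  fix h assume "h \<in> {\<lambda>x. poly p (logistic x) | p. True}"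
  then obtain p where h: "h = (\<lambda>x. poly p (logistic x))" by auto
  have "(h has_real_derivative poly (pderiv p * [:0, 1, - 1:]) (logistic x)) (at x)" for x
    using DERIV_chain2[OF poly_DERIV DERIV_logistic] unfolding h
    by (simp add: logistic'_def algebra_simps)
  then show "\<exists>h'\<in>{\<lambda>x. poly p (logistic x) | p. True}. \<forall>x\<in>UNIV. (h has_real_derivative h' x) (at x)"
    by (intro bexI[of _ "\<lambda>x. poly (pderiv p * [:0, 1, - 1:]) (logistic x)"]) blast+
qed auto

lemma logistic_at_top: "(logistic \<longlongrightarrow> 1) at_top"
  unfolding logistic_def by real_asymp

lemma logistic_at_bot: "(logistic \<longlongrightarrow> 0) at_bot"
  unfolding logistic_def by real_asymp

lemma logistic_scaled_limit:
  assumes "c \<noteq> 0"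
  shows "((\<lambda>R. logistic (c * R)) \<longlongrightarrow> (if c > 0 then 1 else 0)) at_top"
proof (cases "c > 0")
  case True
  then have "filterlim (\<lambda>R. c * R) at_top at_top"
    by (rule filterlim_tendsto_pos_mult_at_top[OF tendsto_const _ filterlim_ident])
  then show ?thesis
    using True filterlim_compose[OF logistic_at_top] by simp
next
  case False
  then have "filterlim (\<lambda>R. c * R) at_bot at_top"
    using assms by (intro filterlim_tendsto_neg_mult_at_bot[OF tendsto_const _ filterlim_ident]) auto
  then show ?thesis
    using False filterlim_compose[OF logistic_at_bot] by simp
qed

text \<open>For large \<open>R\<close> this is close to the indicator of the \<open>N\<close>
  intervals from \<open>2 k R\<close> to \<open>(2 k + 1) R\<close>: a rise at each even multiple of
  \<open>R\<close> and a fall at each odd one.\<close>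

definition bumps :: "nat \<Rightarrow> real \<Rightarrow> real \<Rightarrow> real" where
  "bumps N R t = (\<Sum>k<N. logistic (t - 2 * real k * R) - logistic (t - (2 * real k + 1) * R))"

text \<open>The bumps telescope because consecutive units are ordered.\<close>

lemma bumps_le_1:
  assumes "R \<ge> 0"
  shows "bumps N R t \<le> 1"
proof -
  have "bumps N R t \<le> logistic t - logistic (t - 2 * real N * R)"
  proof (induction N)
    case (Suc N)
    have "logistic (t - 2 * real (Suc N) * R) \<le> logistic (t - (2 * real N + 1) * R)"
      using assms by (intro logistic_mono) (simp add: algebra_simps)
    then show ?case
      using Suc by (simp add: bumps_def)
  qed (simp add: bumps_def)
  then show ?thesis
    using logistic_less_1[of t] logistic_pos[of "t - 2 * real N * R"] by linarith
qed

lemma bumps_tail: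
  assumes "\<epsilon> > 0"
  shows "\<exists>B. \<forall>t. \<bar>t\<bar> > B \<longrightarrow> bumps N R t < \<epsilon>"
proof -
  have top: "filterlim (\<lambda>t::real. t - c) at_top at_top" and bot: "filterlim (\<lambda>t::real. t - c) at_bot at_bot" for c
    by real_asymp+
  have "(bumps N R \<longlongrightarrow> (\<Sum>k<N. 1 - 1)) at_top"
    unfolding bumps_def by (intro tendsto_intros filterlim_compose[OF logistic_at_top] top)
  then have "eventually (\<lambda>t. bumps N R t < \<epsilon>) at_top"
    using assms by (simp add: order_tendstoD)
  then obtain B1 where B1: "\<And>t. t \<ge> B1 \<Longrightarrow> bumps N R t < \<epsilon>"
    by (auto simp: eventually_at_top_linorder)
  have "(bumps N R \<longlongrightarrow> (\<Sum>k<N. 0 - 0)) at_bot"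
    unfolding bumps_def by (intro tendsto_intros filterlim_compose[OF logistic_at_bot] bot)
  then have "eventually (\<lambda>t. bumps N R t < \<epsilon>) at_bot"
    using assms by (simp add: order_tendstoD)
  then obtain B2 where B2: "\<And>t. t \<le> B2 \<Longrightarrow> bumps N R t < \<epsilon>"
    by (auto simp: eventually_at_bot_linorder)
  have "bumps N R t < \<epsilon>" if "\<bar>t\<bar> > max \<bar>B1\<bar> \<bar>B2\<bar>" for t
    using that B1[of t] B2[of t] by linarith
  then show ?thesis by blast
qed

text \<open>At \<open>t = c * R\<close> a unit centred at \<open>j * R\<close> has argument
  \<open>(c - j) * R\<close>, so it tends to a step function of \<open>c - j\<close>; the hypothesis
  keeps \<open>c\<close> away from the jumps.\<close>

lemma bumps_limit:
  assumes "\<And>k. c \<noteq> real k"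
  shows "((\<lambda>R. bumps N R (c * R)) \<longlongrightarrow>
    (\<Sum>k<N. (if c > 2 * real k then 1 else 0) - (if c > 2 * real k + 1 then 1 else 0))) at_top"
proof -
  have lim: "((\<lambda>R. logistic ((c - j) * R)) \<longlongrightarrow> (if c > j then 1 else 0)) at_top" if "c \<noteq> j" for j
    using logistic_scaled_limit[of "c - j"] that by simp
  have "c \<noteq> 2 * real k" "c \<noteq> 2 * real k + 1" for k
    using assms[of "2 * k"] assms[of "2 * k + 1"] by auto
  then have "((\<lambda>R. \<Sum>k<N. logistic ((c - 2 * real k) * R) - logistic ((c - (2 * real k + 1)) * R)) \<longlongrightarrow>
    (\<Sum>k<N. (if c > 2 * real k then 1 else 0) - (if c > 2 * real k + 1 then 1 else 0))) at_top"
    by (intro tendsto_sum tendsto_diff lim)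
  then show ?thesis
    by (simp add: bumps_def left_diff_distrib)
qed

text \<open>The sample points are midpoints of gaps and of plateaus. They are half-integer multiples
  of \<open>R\<close>, which avoid the jumps by parity, and finitely many limits admit a common
  \<open>R\<close>.\<close>

lemma bumps_profile:
  assumes "\<epsilon> > 0"
  obtains R where "R > 0" "\<And>k. k \<le> N \<Longrightarrow> bumps N R ((2 * real k - 1 / 2) * R) < \<epsilon>"
    "\<And>k. k < N \<Longrightarrow> bumps N R ((2 * real k + 1 / 2) * R) > 1 - \<epsilon>"
proof -
  have half: "real a * 2 - 1 / 2 \<noteq> real b" "real a * 2 + 1 / 2 \<noteq> real b" for a b :: nat
  proof -
    show "real a * 2 - 1 / 2 \<noteq> real b"
    proof
      assume "real a * 2 - 1 / 2 = real b"
      then have "real (4 * a) = real (2 * b + 1)" by simp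
      then show False by (metis of_nat_eq_iff even_add even_mult_iff even_numeral odd_one)
    qed
    show "real a * 2 + 1 / 2 \<noteq> real b"
    proof
      assume "real a * 2 + 1 / 2 = real b"
      then have "real (4 * a + 1) = real (2 * b)" by simp
      then show False by (metis of_nat_eq_iff even_add even_mult_iff even_numeral odd_one)
    qed
  qed
  have valley: "((\<lambda>R. bumps N R ((2 * real k - 1 / 2) * R)) \<longlongrightarrow> 0) at_top" for k
  proof -
    have "(if 2 * real k - 1 / 2 > 2 * real l then 1 else 0) - (if 2 * real k - 1 / 2 > 2 * real l + 1 then 1 else 0) = (0::real)" for l
    proof (cases "l < k")
      case True
      then have "real l + 1 \<le> real k" by simp
      then show ?thesis by auto
    qed auto
    then show ?thesis
      using bumps_limit[of "2 * real k - 1 / 2" N] half by (simp add: mult.commute)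
  qed
  have peak: "((\<lambda>R. bumps N R ((2 * real k + 1 / 2) * R)) \<longlongrightarrow> 1) at_top" if "k < N" for k
  proof -
    have "(if 2 * real k + 1 / 2 > 2 * real l then 1 else 0) - (if 2 * real k + 1 / 2 > 2 * real l + 1 then 1 else 0) =
      (if l = k then 1 else 0 :: real)" for l
    proof (cases l k rule: linorder_cases)
      case less
      then have "real l + 1 \<le> real k" by simp
      then show ?thesis using less by auto
    next
      case greater
      then have "real k + 1 \<le> real l" by simp
      then show ?thesis using greater by auto
    qed auto
    then show ?thesis
      using bumps_limit[of "2 * real k + 1 / 2" N] half that by (simp add: mult.commute)
  qed
  have "eventually (\<lambda>R. R > 0 \<and> (\<forall>k\<in>{..N}. bumps N R ((2 * real k - 1 / 2) * R) < \<epsilon>) \<and>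
      (\<forall>k\<in>{..<N}. bumps N R ((2 * real k + 1 / 2) * R) > 1 - \<epsilon>)) at_top"
    using assms valley peak
    by (intro eventually_conj eventually_gt_at_top eventually_ball_finite ballI) (use order_tendstoD(2)[OF valley] order_tendstoD(1)[OF peak] in auto)
  then obtain R where "R > 0" "\<forall>k\<in>{..N}. bumps N R ((2 * real k - 1 / 2) * R) < \<epsilon>"
      "\<forall>k\<in>{..<N}. bumps N R ((2 * real k + 1 / 2) * R) > 1 - \<epsilon>"
    using eventually_happens by force
  then show thesis
    using that[of R] by simp
qed

section \<open>Generic parameters\<close>

text \<open>Sard's theorem in dimension one: the critical values form a negligible set, which cannot
  cover an open interval.\<close>

lemma regular_value_exists:
  fixes \<phi> \<phi>' :: "real \<Rightarrow> real"
  assumes "\<And>t. (\<phi> has_real_derivative \<phi>' t) (at t)" "a < b"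
  obtains y where "a < y" "y < b" "\<And>t. \<phi> t = y \<Longrightarrow> \<phi>' t \<noteq> 0"
proof -
  \<comment> \<open>The function is transported to \<open>real ^ 1\<close>, the setting of
    \<open>baby_Sard\<close>.\<close>
  define F where "F x = (vec (\<phi> (x $ 1)) :: real ^ 1)" for x :: "real ^ 1"
  define S where "S = {x :: real ^ 1. \<phi>' (x $ 1) = 0}"
  have "(F has_derivative (\<lambda>v. 0)) (at x within S)" if "x \<in> S" for x
  proof -
    have "((\<lambda>x::real ^ 1. \<phi> (x $ 1)) has_derivative (\<lambda>v. v $ 1 * \<phi>' (x $ 1))) (at x)"
      by (rule has_derivative_compose[OF bounded_linear.has_derivative[OF bounded_linear_vec_nth has_derivative_ident]
          has_real_derivative_imp_has_derivative[OF assms(1)]])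
    then have "((\<lambda>x::real ^ 1. \<phi> (x $ 1) *\<^sub>R (vec 1 :: real ^ 1)) has_derivative (\<lambda>v. (v $ 1 * \<phi>' (x $ 1)) *\<^sub>R vec 1)) (at x)"
      by (rule has_derivative_scaleR_left)
    moreover have "(\<lambda>x::real ^ 1. \<phi> (x $ 1) *\<^sub>R (vec 1 :: real ^ 1)) = F"
      by (simp add: F_def fun_eq_iff vec_eq_iff)
    ultimately show ?thesis
      using that by (simp add: S_def has_derivative_at_withinI)
  qed
  moreover have "rank (matrix (\<lambda>v::real ^ 1. 0 :: real ^ 1)) < CARD(1)"
    by (simp add: matrix_def rank_0 flip: zero_vec_def)
  ultimately have "negligible (F ` S)"
    by (intro baby_Sard[where f' = "\<lambda>_ _. 0"]) auto
  moreover have "\<not> negligible (box (vec a :: real ^ 1) (vec b))"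
    using assms(2) by (intro open_not_negligible) (auto simp: interval_ne_empty_cart)
  ultimately obtain z where z: "z \<in> box (vec a :: real ^ 1) (vec b)" "z \<notin> F ` S"
    using negligible_subset by blast
  have "\<phi>' t \<noteq> 0" if "\<phi> t = z $ 1" for t
  proof
    assume "\<phi>' t = 0"
    then have "F (vec t) \<in> F ` S"
      by (auto simp: S_def)
    moreover have "F (vec t) = z"
      using that by (simp add: F_def vec_eq_iff)
    ultimately show False using z(2) by simp
  qed
  then show thesis
    using that[of "z $ 1"] z(1) by (auto simp: mem_box_cart)
qed

text \<open>Near a zero the difference quotient stays away from \<open>0\<close>, so the zeros have
  no limit point in the line. Applied to \<open>g'\<close>, this gives countably many critical
  points.\<close>

lemma countable_nondegenerate_zeros:
  fixes h h' :: "real \<Rightarrow> real"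
  assumes der: "\<And>t. (h has_real_derivative h' t) (at t)" and "\<And>t. h t = 0 \<Longrightarrow> h' t \<noteq> 0"
  shows "countable {t. h t = 0}"
proof -
  have "\<not> y islimpt {t. h t = 0}" for y
  proof (cases "h y = 0")
    case True
    have "((\<lambda>t. (h t - h y) / (t - y)) \<longlongrightarrow> h' y) (at y)"
      using der[of y] by (simp add: has_field_derivative_iff)
    then have "eventually (\<lambda>t. (h t - h y) / (t - y) \<noteq> 0) (at y)"
      using assms(2)[OF True] by (rule tendsto_imp_eventually_ne)
    then have "eventually (\<lambda>t. t \<notin> {t. h t = 0}) (at y)"
      by eventually_elim (use True in auto)
    then show ?thesis
      by (simp add: islimpt_iff_eventually)
  next
    case False
    have "(h \<longlongrightarrow> h y) (at y)"
      using der DERIV_isCont isCont_def by blast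
    then have "eventually (\<lambda>t. h t \<noteq> 0) (at y)"
      using False by (rule tendsto_imp_eventually_ne)
    then show ?thesis
      by (simp add: islimpt_iff_eventually)
  qed
  then have "{t. h t = 0} sparse_in UNIV"
    by (auto simp: sparse_in_def)
  then show ?thesis
    using sparse_imp_countable[of UNIV "{t. h t = 0}"] by simp
qed

text \<open>The generic amplitude \<open>\<epsilon>\<close> of the extra unit makes every critical point nondegenerate, since a
  degenerate one is a critical point of \<open>- bumps' / logistic'\<close> with value \<open>\<epsilon>\<close>.\<close>

lemma morse_profile:
  assumes "\<delta> > 0" "2 * N < M"
  obtains d b v q B where
    "\<And>t. (\<Sum>j<M. d j * logistic' (t + b j)) = 0 \<Longrightarrow> (\<Sum>j<M. d j * logistic'' (t + b j)) \<noteq> 0"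
    "\<And>t. (\<Sum>j<M. d j * logistic (t + b j)) \<le> 1 + \<delta>"
    "\<And>t. \<bar>t\<bar> > B \<Longrightarrow> (\<Sum>j<M. d j * logistic (t + b j)) < \<delta>"
    "\<And>k. v k < q k" "\<And>k. q k < v (Suc k)"
    "\<And>k. k \<le> N \<Longrightarrow> (\<Sum>j<M. d j * logistic (v k + b j)) < \<delta>"
    "\<And>k. k < N \<Longrightarrow> (\<Sum>j<M. d j * logistic (q k + b j)) > 1 - \<delta>"
proof -
  \<comment> \<open>Half of the tolerance is spent on the bumps, the other half on the extra unit,
    whose amplitude will be below \<open>\<delta> / 2\<close>.\<close>
  obtain R where R: "R > 0" "\<And>k. k \<le> N \<Longrightarrow> bumps N R ((2 * real k - 1 / 2) * R) < \<delta> / 2"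
    "\<And>k. k < N \<Longrightarrow> bumps N R ((2 * real k + 1 / 2) * R) > 1 - \<delta> / 2"
    using bumps_profile[of "\<delta> / 2" N] assms(1) by (metis half_gt_zero)
  obtain B where B: "\<And>t. \<bar>t\<bar> > B \<Longrightarrow> bumps N R t < \<delta> / 2"
    using bumps_tail[of "\<delta> / 2" N R] assms(1) by auto
  \<comment> \<open>The bumps as one alternating sum over \<open>2 * N\<close> units, with the
    activation \<open>h\<close> left open so that the same operator describes the
    derivatives.\<close>
  define alt where "alt h t = (\<Sum>j<2 * N. (- 1) ^ j * h (t - real j * R))" for h :: "real \<Rightarrow> real" and t
  have alt_bumps: "alt logistic t = bumps N R t" for t
    unfolding alt_def bumps_def by (induction N) (simp_all add: algebra_simps)
  have d_alt: "(alt h has_real_derivative alt h' t) (at t)"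
    if "\<And>t. (h has_real_derivative h' t) (at t)" for h h' t
  proof -
    have "((\<lambda>t. h (t - c)) has_real_derivative h' (t - c) * (1 - 0)) (at t)" for c
      by (rule DERIV_chain2[OF that]) (intro derivative_intros)
    then show ?thesis
      unfolding alt_def by (intro DERIV_sum DERIV_cmult) simp
  qed
  define \<phi> where "\<phi> t = - (alt logistic' t / logistic' t)" for t
  define \<phi>' where "\<phi>' t = - ((alt logistic'' t * logistic' t - alt logistic' t * logistic'' t) / (logistic' t * logistic' t))" for t
  have "(\<phi> has_real_derivative \<phi>' t) (at t)" for t
    unfolding \<phi>_def \<phi>'_def using logistic'_pos[of t]
    by (intro DERIV_minus DERIV_divide d_alt DERIV_logistic') simp
  then obtain \<epsilon> where \<epsilon>: "0 < \<epsilon>" "\<epsilon> < \<delta> / 2" "\<And>t. \<phi> t = \<epsilon> \<Longrightarrow> \<phi>' t \<noteq> 0"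
    using regular_value_exists[of \<phi> \<phi>' 0 "\<delta> / 2"] assms(1) by (metis half_gt_zero)
  \<comment> \<open>The bump units come first, the unit with index \<open>2 * N\<close> is the
    generic one, and zero amplitudes pad the network to exactly \<open>M\<close> units.\<close>
  define d where "d j = (if j < 2 * N then (- 1) ^ j else if j = 2 * N then \<epsilon> else 0)" for j
  define b where "b j = (if j < 2 * N then - (real j * R) else 0)" for j
  have net: "(\<Sum>j<M. d j * h (t + b j)) = alt h t + \<epsilon> * h t" for h t
  proof -
    have "(\<Sum>j<M. d j * h (t + b j)) = (\<Sum>j<Suc (2 * N). d j * h (t + b j))"
      using assms(2) by (intro sum.mono_neutral_right) (auto simp: d_def)
    also have "\<dots> = alt h t + \<epsilon> * h t"
      by (simp add: alt_def d_def b_def)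
    finally show ?thesis .
  qed
  show thesis
  proof (rule that[of d b B "\<lambda>k. (2 * real k - 1 / 2) * R" "\<lambda>k. (2 * real k + 1 / 2) * R"], goal_cases)
    case (1 t)
    then have crit: "alt logistic' t = - \<epsilon> * logistic' t"
      by (simp add: net)
    then have "\<phi>' t \<noteq> 0"
      using logistic'_pos[of t] by (intro \<epsilon>(3)) (simp add: \<phi>_def)
    show ?case
    proof
      assume "(\<Sum>j<M. d j * logistic'' (t + b j)) = 0"
      then have "alt logistic'' t = - \<epsilon> * logistic'' t"
        by (simp add: net)
      with crit have "\<phi>' t = 0"
        by (simp add: \<phi>'_def)
      with \<open>\<phi>' t \<noteq> 0\<close> show False by simp
    qed
  next
    case (2 t)
    have "\<epsilon> * logistic t \<le> \<delta> * 1"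
      using \<epsilon> assms(1) logistic_less_1[of t] logistic_pos[of t] by (intro mult_mono) auto
    then show ?case
      using bumps_le_1[of R N t] R(1) by (simp add: net alt_bumps)
  next
    case (3 t)
    have "\<epsilon> * logistic t \<le> \<delta> / 2 * 1"
      using \<epsilon> assms(1) logistic_less_1[of t] logistic_pos[of t] by (intro mult_mono) auto
    then show ?case
      using B[OF 3] by (simp add: net alt_bumps)
  next
    case (4 k)
    then show ?case using R(1) by simp
  next
    case (5 k)
    then show ?case using R(1) by (intro mult_strict_right_mono) auto
  next
    case (6 k)
    let ?t = "(2 * real k - 1 / 2) * R"
    have "\<epsilon> * logistic ?t \<le> \<delta> / 2 * 1"
      using \<epsilon> assms(1) logistic_less_1[of ?t] logistic_pos[of ?t] by (intro mult_mono) auto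
    then show ?case
      using R(2)[OF 6] unfolding net alt_bumps by linarith
  next
    case (7 k)
    let ?t = "(2 * real k + 1 / 2) * R"
    have "0 \<le> \<epsilon> * logistic ?t"
      using \<epsilon>(1) logistic_pos[of ?t] by simp
    then show ?case
      using R(3)[OF 7] assms(1) unfolding net alt_bumps by linarith
  qed
qed

text \<open>Only countably many points have all coordinates in \<open>Z\<close>, and each excludes a
  single \<open>c\<close>. With \<open>Z\<close> the critical points of \<open>g\<close>, the
  gradient vanishes nowhere on the zero set.\<close>

lemma generic_offset:
  fixes g :: "real \<Rightarrow> real" and Z :: "real set"
  assumes "countable Z" "a < b"
  obtains c where "a < c" "c < b" "\<And>x::real ^ 'n. (\<And>i. x $ i \<in> Z) \<Longrightarrow> c + (\<Sum>i\<in>UNIV. g (x $ i)) \<noteq> 0"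
proof -
  define X where "X = {x::real ^ 'n. \<forall>i. x $ i \<in> Z}"
  have "X \<subseteq> vec_lambda ` PiE UNIV (\<lambda>_. Z)"
  proof
    fix x assume "x \<in> X"
    then have "vec_nth x \<in> PiE UNIV (\<lambda>_. Z)"
      by (auto simp: X_def)
    moreover have "x = vec_lambda (vec_nth x)"
      by simp
    ultimately show "x \<in> vec_lambda ` PiE UNIV (\<lambda>_. Z)"
      by blast
  qed
  moreover have "countable (PiE (UNIV :: 'n set) (\<lambda>_. Z))"
    using assms(1) by (intro countable_PiE) auto
  ultimately have "countable X"
    using countable_image countable_subset by blast
  then have "countable ((\<lambda>x. - (\<Sum>i\<in>UNIV. g (x $ i))) ` X)"
    by simp
  then have "uncountable ({a<..<b} - (\<lambda>x. - (\<Sum>i\<in>UNIV. g (x $ i))) ` X)"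
    using assms(2) by (intro uncountable_minus_countable) (simp_all add: uncountable_open_interval)
  then have "{a<..<b} - (\<lambda>x. - (\<Sum>i\<in>UNIV. g (x $ i))) ` X \<noteq> {}"
    by (rule contrapos_nn) (simp only: countable_empty)
  then obtain c where "c \<in> {a<..<b}" "c \<notin> (\<lambda>x. - (\<Sum>i\<in>UNIV. g (x $ i))) ` X"
    by blast
  then show thesis
    using that[of c] by (auto simp: X_def image_iff add_eq_0_iff2)
qed

section \<open>Assembly of the network and its constants\<close>

lemma has_lattice_constant_axes:
  fixes \<iota> :: "nat \<Rightarrow> 'n::finite"
  assumes "A \<noteq> {}"
  shows "has_lattice_constant ((\<lambda>k. axis (\<iota> k) 1 :: real ^ 'n) ` A) 1"
proof -
  let ?E = "{\<bar>v $ i\<bar> | v i. v \<in> (\<lambda>k. axis (\<iota> k) 1 :: real ^ 'n) ` A}"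
  have sub: "?E \<subseteq> {0, 1}"
    by (auto simp: axis_def split: if_splits)
  obtain k where "k \<in> A"
    using assms by blast
  then have "\<bar>(axis (\<iota> k) 1 :: real ^ 'n) $ \<iota> k\<bar> \<in> ?E"
    by blast
  then have "1 \<in> ?E"
    by (simp add: axis_def)
  have "Max ?E = 1"
  proof (rule Max_eqI)
    show "finite ?E"
      using sub finite_subset by blast
    show "y \<le> 1" if "y \<in> ?E" for y
      using subsetD[OF sub that] by auto
  qed fact
  moreover have "(axis (\<iota> k) 1 :: real ^ 'n) $ i \<in> \<int>" for k i
    by (simp add: axis_def)
  ultimately show ?thesis
    unfolding has_lattice_constant_def by (intro exI[of _ 1]) auto
qed

lemma ereal_le_mdeg:
  assumes "enat k \<le> mdeg V" "x \<le> real k"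
  shows "ereal x \<le> ereal_of_enat (mdeg V)"
proof -
  have "ereal x \<le> ereal_of_enat (enat k)"
    using assms(2) by simp
  also have "\<dots> \<le> ereal_of_enat (mdeg V)"
    using assms(1) by (simp only: ereal_of_enat_le_iff)
  finally show ?thesis .
qed

lemma network_exists:
  assumes "m \<ge> 4" "even m"
  shows "\<exists>(c0::real) (d::nat \<Rightarrow> real) (\<iota>::nat \<Rightarrow> 'n::finite) (b::nat \<Rightarrow> real).
    let f = sigmoid_net (CARD('n) * (m + 2)) c0 d (\<lambda>k. axis (\<iota> k) 1 :: real ^ 'n) b; V = {x. f x = 0}
    in regular_value UNIV UNIV f 0 \<and> smooth_hypersurface V \<and> compact V \<and>
      enat (2 * ((m - 2) div 2) ^ CARD('n)) \<le> mdeg V"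
proof -
  define n where "n = real CARD('n)"
  define N where "N = (m - 2) div 2"
  \<comment> \<open>Chosen so that \<open>(n + 1) * \<delta> = 1 / 2\<close>, the tolerance under
    which both the compactness and the counting estimate hold.\<close>
  define \<delta> where "\<delta> = 1 / (2 * (n + 1))"
  have n: "n \<ge> 1"
    by (simp add: n_def Suc_leI)
  then have \<delta>: "\<delta> > 0" "(n + 1) * \<delta> = 1 / 2"
    by (simp_all add: \<delta>_def field_simps)
  have N: "2 * N < m + 2"
    by (simp add: N_def)
  obtain d b v q B where
    morse: "\<And>t. (\<Sum>j<m + 2. d j * logistic' (t + b j)) = 0 \<Longrightarrow> (\<Sum>j<m + 2. d j * logistic'' (t + b j)) \<noteq> 0"
    and upper: "\<And>t. (\<Sum>j<m + 2. d j * logistic (t + b j)) \<le> 1 + \<delta>"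
    and tail: "\<And>t. \<bar>t\<bar> > B \<Longrightarrow> (\<Sum>j<m + 2. d j * logistic (t + b j)) < \<delta>"
    and vq: "\<And>k::nat. v k < q k" "\<And>k. q k < v (Suc k)"
    and valley: "\<And>k. k \<le> N \<Longrightarrow> (\<Sum>j<m + 2. d j * logistic (v k + b j)) < \<delta>"
    and peak: "\<And>k. k < N \<Longrightarrow> (\<Sum>j<m + 2. d j * logistic (q k + b j)) > 1 - \<delta>"
    by (rule morse_profile[OF \<delta>(1) N]) (rule that)
  define net where "net h t = (\<Sum>j<m + 2. d j * h (t + b j))" for h :: "real \<Rightarrow> real" and t
  note profile = morse upper tail valley peak
  note profile = profile[folded net_def]
  have der: "(net h has_real_derivative net h' t) (at t)"
    if "\<And>t. (h has_real_derivative h' t) (at t)" for h h' t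
  proof -
    have "((\<lambda>t. h (t + c)) has_real_derivative h' (t + c) * (1 + 0)) (at t)" for c
      by (rule DERIV_chain2[OF that]) (intro derivative_intros)
    then show ?thesis
      unfolding net_def by (intro DERIV_sum DERIV_cmult) simp
  qed
  have smooth: "smooth_on UNIV (net logistic)"
    unfolding net_def
    by (intro smooth_on_sum smooth_on_mult smooth_on_const smooth_on_add smooth_on_id
        smooth_on_compose[OF smooth_on_logistic]) auto
  have count: "countable {t. net logistic' t = 0}"
    by (rule countable_nondegenerate_zeros[OF der[OF DERIV_logistic'] profile(1)])
  \<comment> \<open>The offset is taken just below \<open>- (n - 1 / 2)\<close>: the upper bound
    serves compactness, and both bounds together place the flank value near
    \<open>1 / 2\<close>.\<close>
  have "- (n - 1 / 2) - \<delta> < - (n - 1 / 2)"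
    using \<delta>(1) by simp
  from generic_offset[OF count this, of "net logistic", where 'n = 'n]
  obtain c0 where c0: "- (n - 1 / 2) - \<delta> < c0" "c0 < - (n - 1 / 2)"
    and generic: "\<And>x::real ^ 'n. (\<And>i. net logistic' (x $ i) = 0) \<Longrightarrow>
      c0 + (\<Sum>i\<in>UNIV. net logistic (x $ i)) \<noteq> 0"
    by simp metis
  define w where "w = CARD('n) * (m + 2)"
  \<comment> \<open>Units are enumerated as pairs of a coordinate and an index within the
    one-variable network, so all weights are coordinate axes.\<close>
  obtain e :: "nat \<Rightarrow> 'n \<times> nat" where e: "bij_betw e {1..w} (UNIV \<times> {..<m + 2})"
    using finite_same_card_bij[of "{1..w}" "(UNIV :: 'n set) \<times> {..<m + 2}"] by (auto simp: w_def)
  define f where "f = sigmoid_net w c0 (\<lambda>k. d (snd (e k))) (\<lambda>k. axis (fst (e k)) 1 :: real ^ 'n) (\<lambda>k. b (snd (e k)))"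
  have f_eq: "f x = c0 + (\<Sum>i\<in>UNIV. net logistic (x $ i))" for x
  proof -
    have "f x = c0 + (\<Sum>k=1..w. (\<lambda>(i, j). d j * logistic (x $ i + b j)) (e k))"
      by (simp add: f_def sigmoid_net_def inner_axis' split_beta)
    also have "(\<Sum>k=1..w. (\<lambda>(i, j). d j * logistic (x $ i + b j)) (e k)) =
        (\<Sum>(i, j)\<in>UNIV \<times> {..<m + 2}. d j * logistic (x $ i + b j))"
      by (rule sum.reindex_bij_betw[OF e])
    finally show ?thesis
      by (simp only: net_def sum.cartesian_product)
  qed
  define V where "V = {x. f x = 0}"
  interpret separable_level "net logistic" "net logistic'" "net logistic''" c0 f V
  proof
    show "\<exists>i. net logistic' (x $ i) \<noteq> 0" if "x \<in> V" for x
      using that generic[of x] f_eq by (auto simp: V_def)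
  qed (use smooth der DERIV_logistic DERIV_logistic' profile(1) f_eq V_def in blast)+
  have "compact V"
    by (rule compact_V[OF profile(2,3)]) (use c0 \<delta> in \<open>auto simp: algebra_simps simp flip: n_def\<close>)
  moreover have "enat (2 * N ^ CARD('n)) \<le> mdeg V"
    by (rule mdeg_ge_peaks[where v = v and q = q and \<delta> = \<delta>, OF vq profile(4,5,2)]) (use c0 \<delta> in \<open>auto simp: abs_less_iff simp flip: n_def\<close>)
  ultimately have "let f = f; V = {x. f x = 0}
    in regular_value UNIV UNIV f 0 \<and> smooth_hypersurface V \<and> compact V \<and>
      enat (2 * ((m - 2) div 2) ^ CARD('n)) \<le> mdeg V"
    using regular_value_f smooth_hypersurface_V by (simp add: V_def N_def)
  then show ?thesis
    unfolding f_def w_def by (intro exI)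
qed

theorem proposition4p11:
  shows "\<exists>C>0. \<forall>m::nat. m \<ge> 4 \<and> even m \<longrightarrow>
    (\<exists>(c0::real) (d::nat \<Rightarrow> real) (a::nat \<Rightarrow> real ^ 'n) (b::nat \<Rightarrow> real).
       let w = CARD('n) * (m + 2);
           f = sigmoid_net w c0 d a b;
           V = {x. f x = 0}
       in (\<forall>k\<in>{1..w}. \<forall>i. a k $ i \<in> \<rat>) \<and>
          has_lattice_constant (a ` {1..w}) 1 \<and>
          regular_value UNIV UNIV f 0 \<and>
          smooth_hypersurface V \<and> compact V \<and>
          ereal (2 * ((real m - 2) / 2) ^ CARD('n)) \<le> ereal_of_enat (mdeg V) \<and>
          ereal (C * real w ^ CARD('n)) \<le> ereal_of_enat (mdeg V))"
proof -
  let ?n = "CARD('n)"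
  \<comment> \<open>For \<open>m \<ge> 4\<close> one has \<open>m + 2 \<le> 3 * (m - 2)\<close>, so
    the number of units divided by \<open>6 * ?n\<close> is at most
    \<open>(m - 2) / 2\<close>.\<close>
  define C where "C = 2 / (6 * real ?n) ^ ?n"
  have "C > 0"
    by (simp add: C_def)
  moreover have "\<exists>(c0::real) (d::nat \<Rightarrow> real) (a::nat \<Rightarrow> real ^ 'n) (b::nat \<Rightarrow> real).
       let w = CARD('n) * (m + 2);
           f = sigmoid_net w c0 d a b;
           V = {x. f x = 0}
       in (\<forall>k\<in>{1..w}. \<forall>i. a k $ i \<in> \<rat>) \<and>
          has_lattice_constant (a ` {1..w}) 1 \<and>
          regular_value UNIV UNIV f 0 \<and>
          smooth_hypersurface V \<and> compact V \<and>
          ereal (2 * ((real m - 2) / 2) ^ CARD('n)) \<le> ereal_of_enat (mdeg V) \<and>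
          ereal (C * real w ^ CARD('n)) \<le> ereal_of_enat (mdeg V)"
    if m: "m \<ge> 4" "even m" for m :: nat
  proof -
    obtain c0 d b and \<iota> :: "nat \<Rightarrow> 'n" where net:
      "let f = sigmoid_net (?n * (m + 2)) c0 d (\<lambda>k. axis (\<iota> k) 1 :: real ^ 'n) b; V = {x. f x = 0}
       in regular_value UNIV UNIV f 0 \<and> smooth_hypersurface V \<and> compact V \<and>
         enat (2 * ((m - 2) div 2) ^ ?n) \<le> mdeg V"
      using network_exists[OF m] by blast
    have half: "real ((m - 2) div 2) = (real m - 2) / 2"
    proof -
      have "2 * ((m - 2) div 2) = m - 2"
        using m by simp
      then have "2 * real ((m - 2) div 2) = real (m - 2)"
        by (metis of_nat_mult of_nat_numeral)
      then show ?thesis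
        using m by (simp add: of_nat_diff)
    qed
    have "real (?n * (m + 2)) / (6 * real ?n) \<le> (real m - 2) / 2"
      using m(1) by (simp add: field_simps)
    then have "(real (?n * (m + 2)) / (6 * real ?n)) ^ ?n \<le> ((real m - 2) / 2) ^ ?n"
      by (intro power_mono) auto
    then have C: "C * real (?n * (m + 2)) ^ ?n \<le> 2 * ((real m - 2) / 2) ^ ?n"
      by (simp add: C_def power_divide)
    have rat: "(axis (\<iota> k) 1 :: real ^ 'n) $ i \<in> \<rat>" for k i
      by (simp add: axis_def)
    have "{1..?n * (m + 2)} \<noteq> {}"
      by (simp add: Suc_le_eq)
    note lattice = has_lattice_constant_axes[OF this, of \<iota>]
    define V where "V = {x. sigmoid_net (?n * (m + 2)) c0 d (\<lambda>k. axis (\<iota> k) 1 :: real ^ 'n) b x = 0}"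
    have mdeg: "enat (2 * ((m - 2) div 2) ^ ?n) \<le> mdeg V"
      using net by (simp add: V_def Let_def)
    have "ereal (2 * ((real m - 2) / 2) ^ ?n) \<le> ereal_of_enat (mdeg V)"
      and "ereal (C * real (?n * (m + 2)) ^ ?n) \<le> ereal_of_enat (mdeg V)"
      using C by (intro ereal_le_mdeg[OF mdeg]; simp add: half)+
    then show ?thesis
      using net rat lattice unfolding Let_def V_def
      by - (rule exI[of _ c0], rule exI[of _ d], rule exI[of _ "\<lambda>k. axis (\<iota> k) 1"], rule exI[of _ b], blast)
  qed
  ultimately show ?thesis
    by (intro exI[of _ C]) blast
qed

end
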